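(* Let $d \ge 2$ and let $B^d\subset\mathbb{R}^d$ be the unit ball centered at the origin. Let $K \subset B^d$ be a convex body such that \[ \operatorname{diam}(K) < \log\frac{1+\sqrt{\frac2{d+1}}}{1-\sqrt{\frac2{d+1}}} \] in the hyperbolic metric defined by $B^d$ as a Cayley–Klein model. Then there exists a unique point $y \in \operatorname{int} K$ such that the centroids of the polars of $K$ and $B^d$ with respect to $y$ coincide. The bound is sharp: the constant on the right-hand side cannot be replaced by any larger one.
   Context: A convex body is a compact convex set with non-empty interior; the centroid of $K$ is $\frac{1}{\operatorname{vol}(K)} \int_K x\, dx$. The polar of $L$ with respect to $y$ is $L^\circ_y = \{x \in \mathbb{R}^d \mid \langle x-y, z-y \rangle \ge -1 \ \forall z \in L\}$. The hyperbolic distance in the Cayley–Klein model $B^d$ between $p, q$ is $\frac12 |\log |\operatorname{cr}(p,q;a,b)||$, where $a,b$ are the points of $\partial B^d$ collinear with $p,q$ and $\operatorname{cr}(p,q;a,b) = \frac{(p-a)(q-b)}{(p-b)(q-a)}$; $\operatorname{diam}(K)$ is the maximum (supremum, possibly $+\infty$) of the hyperbolic distance over $p,q\in K$. *)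

theory Defs
  imports "HOL-Analysis.Analysis"
begin

definition convex_body :: "(real ^ 'n) set \<Rightarrow> bool" where
  "convex_body K \<longleftrightarrow> compact K \<and> convex K \<and> interior K \<noteq> {}"

definition centroid :: "(real ^ 'n) set \<Rightarrow> real ^ 'n" where
  "centroid K = (1 / measure lborel K) *\<^sub>R (LINT x:K|lborel. x)"

definition polar_wrt :: "real ^ 'n \<Rightarrow> (real ^ 'n) set \<Rightarrow> (real ^ 'n) set" where
  "polar_wrt y L = {x. \<forall>z\<in>L. (x - y) \<bullet> (z - y) \<ge> -1}"

text \<open>For collinear points the quotients of difference vectors in the cross-ratio are scalars,
  and their absolute values are quotients of Euclidean distances.\<close>

definition abs_cross_ratio :: "real ^ 'n \<Rightarrow> real ^ 'n \<Rightarrow> real ^ 'n \<Rightarrow> real ^ 'n \<Rightarrow> real" where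
  "abs_cross_ratio p q a b = (dist p a * dist q b) / (dist p b * dist q a)"

text \<open>Distance in the Cayley--Klein model given by the unit ball. The value does not depend on
  the order of the two endpoints of the chord through the points. Points of the unit sphere are
  at infinite distance from all other points; this case is separate because division by zero and
  \<^term>\<open>ln 0\<close> would otherwise yield finite values.\<close>

definition hyperbolic_dist :: "real ^ 'n \<Rightarrow> real ^ 'n \<Rightarrow> ereal" where
  "hyperbolic_dist p q =
     (if p = q then 0
      else if norm p \<ge> 1 \<or> norm q \<ge> 1 then \<infinity>
      else ereal (THE r. \<exists>a b. a \<noteq> b \<and> affine hull {p, q} \<inter> sphere 0 1 = {a, b} \<and>
                           r = 1 / 2 * \<bar>ln (abs_cross_ratio p q a b)\<bar>))"

definition hyperbolic_diam :: "(real ^ 'n) set \<Rightarrow> ereal" where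
  "hyperbolic_diam K = (SUP p\<in>K. SUP q\<in>K. hyperbolic_dist p q)"

end

theory Submission
  imports Defs "HOL-Probability.Distributions" "HOL-Real_Asymp.Real_Asymp"
begin

text \<open>
  Let \<open>K\<close> be a convex body in the open unit ball, \<open>y\<close> an interior point and \<open>W\<close> the polar of
  \<open>K\<close> with respect to \<open>y\<close>, shifted so that \<open>y\<close> becomes the origin.  Then \<open>W = {g \<le> 1}\<close> for the
  gauge \<open>g w = sup {w \<bullet> (y - z) | z \<in> K}\<close>.  Integrals over \<open>W\<close> of homogeneous functions turn into
  integrals over the whole space against \<open>exp (- g)\<close> (\<open>integral_homogeneous_exp\<close>); in particular
  \<open>d! vol W = \<integral> exp (- g)\<close>.  Since \<open>g\<close> depends on \<open>y\<close> only through the linear summand \<open>w \<bullet> y\<close>,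
  this integral is a Laplace transform in \<open>y\<close>: it is convex, it can be differentiated under the
  integral sign, and its logarithmic gradient is \<open>- (d + 1)\<close> times the centroid of \<open>W\<close>.  The
  polar of the unit ball is an ellipsoid, and the reflection of this ellipsoid in its centre gives
  its shifted centroid as \<open>- y / (1 - |y|\<^sup>2)\<close>.  So the two centroids coincide exactly at the
  critical points in \<open>interior K\<close> of the potential
  \<open>F y = ln (\<integral> exp (- g)) + (d + 1) / 2 * ln (1 - |y|\<^sup>2)\<close>.

  Existence.  Near the boundary of \<open>K\<close> the polar contains long rows of disjoint balls, so \<open>F\<close>
  tends to infinity there and attains its minimum (\<open>centroid_gap_zero_exists\<close>).

  Uniqueness.  Restrict \<open>F\<close> to a line with direction \<open>u\<close>.  Where the first derivative vanishes,
  the second one is, up to a positive factor, the difference of the variances in direction \<open>u\<close>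
  of the polars of \<open>K\<close> and of the ball.  A convex body of width \<open>\<omega>\<close> in direction \<open>u\<close> has variance
  at least \<open>\<omega>\<^sup>2 / (2 (d + 1) (d + 2))\<close> (\<open>second_moment_ge_width\<close>; the extremal bodies are double
  cones), while an ellipsoid of width \<open>\<omega>'\<close> has variance \<open>\<omega>'\<^sup>2 / (4 (d + 2))\<close>.  By duality
  \<open>\<omega>\<close> is determined by the chord of \<open>K\<close> through \<open>y\<close> parallel to \<open>u\<close> and \<open>\<omega>'\<close> by the chord of the
  ball; the bound on the hyperbolic length of the former implies
  \<open>\<omega>\<^sup>2 > (d + 1) / 2 * \<omega>'\<^sup>2\<close> (\<open>hyperbolic_dist_less_imp_width\<close>).  Hence every critical point of the
  restriction is a strict local minimum, and there can be only one
  (\<open>centroid_gap_zero_unique\<close>).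

  Sharpness.  The polar of a box with respect to its centre is a cross-polytope, hence a double
  cone.  A thin box around a segment of half-length slightly above \<open>sqrt (2 / (d + 1))\<close> has hyperbolic
  diameter slightly above the bound, and for it the derivative of \<open>F\<close> is explicit: on the long axis
  it vanishes at the centre and at two further points (\<open>box_with_two_common_centroids\<close>).
\<close>

section \<open>Integrals of homogeneous functions against an exponential\<close>

lemma nn_integral_lborel_affine:
  fixes f :: "'a::euclidean_space \<Rightarrow> ennreal"
  assumes [measurable]: "f \<in> borel_measurable borel" and "c \<noteq> 0"
  shows "(\<integral>\<^sup>+x. f x \<partial>lborel) = ennreal (\<bar>c\<bar> ^ DIM('a)) * (\<integral>\<^sup>+x. f (t + c *\<^sub>R x) \<partial>lborel)"
  by (subst lborel_affine[OF \<open>c \<noteq> 0\<close>, of t])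
    (simp add: nn_integral_density nn_integral_distr nn_integral_cmult)

lemma integral_lborel_affine:
  fixes f :: "'a::euclidean_space \<Rightarrow> real"
  assumes [measurable]: "f \<in> borel_measurable borel" and "c \<noteq> 0"
  shows "(LINT x|lborel. f x) = \<bar>c\<bar> ^ DIM('a) * (LINT x|lborel. f (t + c *\<^sub>R x))"
  by (subst lborel_affine[OF \<open>c \<noteq> 0\<close>, of t])
    (simp add: integral_density integral_distr)

lemma exp_minus_eq_nn_integral:
  fixes a :: real
  assumes "0 \<le> a"
  shows "ennreal (exp (- a)) = (\<integral>\<^sup>+t. ennreal (exp (- t)) * indicator {a..} t \<partial>lborel)"
proof -
  have "(\<integral>\<^sup>+t. ennreal (exp (- t)) * indicator {a..} t \<partial>lborel)
      = ennreal (0 - (- exp (- a)))"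
  proof (rule nn_integral_FTC_atLeast)
    show "((\<lambda>t. - exp (- t)) \<longlongrightarrow> (0::real)) at_top"
      using tendsto_minus[OF filterlim_compose[OF exp_at_bot filterlim_uminus_at_bot_at_top]]
      by simp
  qed (auto intro!: derivative_eq_intros)
  then show ?thesis by simp
qed

lemma ennreal_fact: "ennreal (fact n) = fact n"
  by (metis ennreal_of_nat_eq_real_of_nat of_nat_fact)

text \<open>Layer-cake formula: \<open>exp (- g x)\<close> is the integral of \<open>exp (- t)\<close> over \<open>t \<ge> g x\<close>, and by
  homogeneity the integral of \<open>f\<close> over \<open>{g \<le> t}\<close> is \<open>t ^ (d + k)\<close> times that over \<open>{g \<le> 1}\<close>.  What
  remains is the Gamma integral.\<close>
lemma nn_integral_homogeneous_exp:
  fixes f g :: "'a::euclidean_space \<Rightarrow> real"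
  assumes f[measurable]: "f \<in> borel_measurable borel"
    and g[measurable]: "g \<in> borel_measurable borel"
    and g0: "\<And>x. 0 \<le> g x"
    and fh: "\<And>c x. 0 < c \<Longrightarrow> f (c *\<^sub>R x) = c ^ k * f x"
    and gh: "\<And>c x. 0 < c \<Longrightarrow> g (c *\<^sub>R x) = c * g x"
  shows "(\<integral>\<^sup>+x. ennreal (f x * exp (- g x)) \<partial>lborel) =
    fact (DIM('a) + k) * (\<integral>\<^sup>+x. ennreal (f x) * indicator {x. g x \<le> 1} x \<partial>lborel)"
proof -
  let ?n = "DIM('a) + k"
  let ?V = "\<integral>\<^sup>+x. ennreal (f x) * indicator {x. g x \<le> 1} x \<partial>lborel"
  have sub: "(\<integral>\<^sup>+x. ennreal (f x) * indicator {g x..} t \<partial>lborel)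
      = ennreal (t ^ ?n) * ?V" if "0 < t" for t
  proof -
    have "(\<integral>\<^sup>+x. ennreal (f x) * indicator {g x..} t \<partial>lborel)
       = ennreal (\<bar>t\<bar> ^ DIM('a)) * (\<integral>\<^sup>+x. ennreal (f (0 + t *\<^sub>R x)) * indicator {g (0 + t *\<^sub>R x)..} t \<partial>lborel)"
    proof (rule nn_integral_lborel_affine)
      show "(\<lambda>x. ennreal (f x) * indicator {g x..} t) \<in> borel_measurable borel"
        unfolding indicator_def atLeast_iff by measurable
    qed (use that in simp)
    also have "(\<lambda>x. ennreal (f (0 + t *\<^sub>R x)) * indicator {g (0 + t *\<^sub>R x)..} t)
       = (\<lambda>x. ennreal (t ^ k) * (ennreal (f x) * indicator {x. g x \<le> 1} x))"
      using that
      by (auto simp: fun_eq_iff fh gh ennreal_mult' indicator_def mult_le_cancel_left1)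
    also have "(\<integral>\<^sup>+x. ennreal (t ^ k) * (ennreal (f x) * indicator {x. g x \<le> 1} x) \<partial>lborel)
       = ennreal (t ^ k) * ?V"
      by (intro nn_integral_cmult) measurable
    finally show ?thesis
      using that by (simp add: power_add ennreal_mult' mult.assoc)
  qed
  have "(\<integral>\<^sup>+x. ennreal (f x * exp (- g x)) \<partial>lborel)
     = (\<integral>\<^sup>+x. \<integral>\<^sup>+t. ennreal (f x) * (ennreal (exp (- t)) * indicator {g x..} t) \<partial>lborel \<partial>lborel)"
    by (intro nn_integral_cong)
      (simp add: ennreal_mult'' exp_minus_eq_nn_integral[OF g0] nn_integral_cmult)
  also have "\<dots> = (\<integral>\<^sup>+t. \<integral>\<^sup>+x. ennreal (f x) * (ennreal (exp (- t)) * indicator {g x..} t) \<partial>lborel \<partial>lborel)"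
    unfolding indicator_def atLeast_iff
    by (rule lborel_pair.Fubini') measurable
  also have "\<dots> = (\<integral>\<^sup>+t. ennreal (t ^ ?n * exp (- t)) * indicator {0..} t * ?V \<partial>lborel)"
  proof (rule nn_integral_cong_AE, rule AE_mp)
    show "AE t in lborel. t \<noteq> (0::real)"
      by (rule AE_lborel_singleton)
    show "AE t in lborel. t \<noteq> (0::real) \<longrightarrow>
      (\<integral>\<^sup>+x. ennreal (f x) * (ennreal (exp (- t)) * indicator {g x..} t) \<partial>lborel)
      = ennreal (t ^ ?n * exp (- t)) * indicator {0..} t * ?V"
    proof (intro AE_I2 impI)
      fix t :: real assume "t \<noteq> 0"
      then consider "t < 0" | "0 < t" by linarith
      then show "(\<integral>\<^sup>+x. ennreal (f x) * (ennreal (exp (- t)) * indicator {g x..} t) \<partial>lborel)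
        = ennreal (t ^ ?n * exp (- t)) * indicator {0..} t * ?V"
      proof cases
        case 1
        then have "indicator {g x..} t = (0::ennreal)" for x
          using g0[of x] by (auto simp: indicator_def)
        then show ?thesis using 1 by simp
      next
        case 2
        have "(\<integral>\<^sup>+x. ennreal (f x) * (ennreal (exp (- t)) * indicator {g x..} t) \<partial>lborel)
          = (\<integral>\<^sup>+x. ennreal (exp (- t)) * (ennreal (f x) * indicator {g x..} t) \<partial>lborel)"
          by (simp add: mult_ac)
        also have "\<dots> = ennreal (exp (- t)) * (\<integral>\<^sup>+x. ennreal (f x) * indicator {g x..} t \<partial>lborel)"
          unfolding indicator_def atLeast_iff by (intro nn_integral_cmult) measurable
        finally show ?thesis using 2 by (simp add: sub ennreal_mult' mult_ac)
      qed
    qed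
  qed
  also have "\<dots> = (\<integral>\<^sup>+t. ennreal (t ^ ?n * exp (- t)) * indicator {0..} t \<partial>lborel) * ?V"
    by (intro nn_integral_multc) measurable
  also have "\<dots> = fact ?n * ?V"
    by (simp only: nn_intergal_power_times_exp_Ici) (simp add: ennreal_fact)
  finally show ?thesis .
qed

lemma integral_homogeneous_exp:
  fixes f g :: "'a::euclidean_space \<Rightarrow> real"
  assumes f[measurable]: "f \<in> borel_measurable borel"
    and g[measurable]: "g \<in> borel_measurable borel"
    and g0: "\<And>x. 0 \<le> g x"
    and fh: "\<And>c x. 0 < c \<Longrightarrow> f (c *\<^sub>R x) = c ^ k * f x"
    and gh: "\<And>c x. 0 < c \<Longrightarrow> g (c *\<^sub>R x) = c * g x"
    and int: "set_integrable lborel {x. g x \<le> 1} f"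
  shows "integrable lborel (\<lambda>x. f x * exp (- g x))"
    and "(LINT x|lborel. f x * exp (- g x)) = fact (DIM('a) + k) * (LINT x:{x. g x \<le> 1}|lborel. f x)"
proof -
  let ?S = "{x. g x \<le> 1}"
  have P: "(\<integral>\<^sup>+x. ennreal (f x * exp (- g x)) \<partial>lborel)
      = fact (DIM('a) + k) * (\<integral>\<^sup>+x. ennreal (indicator ?S x *\<^sub>R f x) \<partial>lborel)"
    by (subst nn_integral_homogeneous_exp[OF f g g0 fh gh])
      (auto intro!: arg_cong2[where f="(*)"] nn_integral_cong simp: indicator_def)
  have N: "(\<integral>\<^sup>+x. ennreal (- (f x * exp (- g x))) \<partial>lborel)
      = fact (DIM('a) + k) * (\<integral>\<^sup>+x. ennreal (- (indicator ?S x *\<^sub>R f x)) \<partial>lborel)"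
  proof -
    have "(\<integral>\<^sup>+x. ennreal (- f x * exp (- g x)) \<partial>lborel) =
       fact (DIM('a) + k) * (\<integral>\<^sup>+x. ennreal (- f x) * indicator ?S x \<partial>lborel)"
      by (rule nn_integral_homogeneous_exp) (auto simp: g0 fh gh)
    then show ?thesis
      by (auto intro!: arg_cong2[where f="(*)"] nn_integral_cong simp: indicator_def)
  qed
  have fin: "(\<integral>\<^sup>+x. ennreal (indicator ?S x *\<^sub>R f x) \<partial>lborel) \<noteq> \<infinity>"
      "(\<integral>\<^sup>+x. ennreal (- (indicator ?S x *\<^sub>R f x)) \<partial>lborel) \<noteq> \<infinity>"
    using int unfolding set_integrable_def real_integrable_def by auto
  show I: "integrable lborel (\<lambda>x. f x * exp (- g x))"
    unfolding real_integrable_def using fin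
    by (auto simp: P N ennreal_mult_eq_top_iff simp flip: ennreal_fact)
  show "(LINT x|lborel. f x * exp (- g x)) = fact (DIM('a) + k) * (LINT x:?S|lborel. f x)"
    unfolding real_lebesgue_integral_def[OF I] P N set_lebesgue_integral_def
      real_lebesgue_integral_def[OF int[unfolded set_integrable_def]]
    by (simp add: enn2real_mult right_diff_distrib flip: ennreal_fact)
qed

section \<open>Second moments of convex bodies of given width\<close>

text \<open>If \<open>S\<close> is the full cone with apex \<open>p\<close> and height \<open>L\<close> in direction \<open>u\<close>, then the height
  \<open>\<tau> w = u \<bullet> (w - p)\<close> has the density proportional to \<open>\<tau> ^ (d - 1)\<close> on \<open>[0, L]\<close>, and equality holds.
  A general \<open>S\<close> that is star-shaped about \<open>p\<close> has relatively more mass near the apex.  Let \<open>\<eta>\<close> be a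
  quadratic polynomial that is nonnegative on \<open>[0, L]\<close>.  Its integral \<open>P c\<close> over the copy
  of \<open>S\<close> shrunk towards \<open>p\<close> by the factor \<open>c\<close> is a polynomial in \<open>c\<close>, and it is at most \<open>P 1\<close> because
  the shrunk copy lies in \<open>S\<close>.  So the derivative of \<open>P\<close> at \<open>1\<close> is nonnegative, and for a suitable \<open>\<eta>\<close>
  this is the claim.\<close>
lemma star_shaped_second_moment:
  fixes S :: "'a::euclidean_space set" and u p :: 'a
  assumes S: "S \<in> sets borel" "bounded S"
    and star: "\<And>w c. w \<in> S \<Longrightarrow> 0 < c \<Longrightarrow> c \<le> 1 \<Longrightarrow> p + c *\<^sub>R (w - p) \<in> S"
    and rng: "\<And>w. w \<in> S \<Longrightarrow> 0 \<le> u \<bullet> (w - p) \<and> u \<bullet> (w - p) \<le> L"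
    and xi: "L * (real DIM('a) + 1) / (real DIM('a) + 2) \<le> \<xi>"
  shows "(\<xi>\<^sup>2 - 2 * \<xi> * L * real DIM('a) / (real DIM('a) + 1) + L\<^sup>2 * real DIM('a) / (real DIM('a) + 2)) * measure lborel S
    \<le> (LINT w:S|lborel. (u \<bullet> (w - p) - \<xi>)\<^sup>2)"
proof -
  define d where "d = real DIM('a)"
  have d: "d \<ge> 1" unfolding d_def by (simp add: Suc_leI)
  define \<tau> where "\<tau> w = u \<bullet> (w - p)" for w
  have [measurable]: "S \<in> sets borel" by fact
  have \<tau>m[measurable]: "\<tau> \<in> borel_measurable borel" unfolding \<tau>_def by measurable
  have fin: "emeasure lborel S < \<infinity>"
    using emeasure_bounded_finite[OF S(2)] by simp
  have int[simp]: "integrable lborel (\<lambda>w. indicator S w * \<tau> w ^ k)" for k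
  proof (rule integrableI_bounded_set[where A=S and B="L ^ k"])
    show "AE x in lborel. x \<in> S \<longrightarrow> norm (indicator S x * \<tau> x ^ k) \<le> L ^ k"
      using rng by (auto intro!: AE_I2 power_mono simp: \<tau>_def)
  qed (use fin in auto)
  define M where "M k = (LINT w|lborel. indicator S w * \<tau> w ^ k)" for k
  have lin: "(LINT w|lborel. x0 * (indicator S w * \<tau> w ^ 0) + x1 * (indicator S w * \<tau> w ^ 1)
      + x2 * (indicator S w * \<tau> w ^ 2)) = x0 * M 0 + x1 * M 1 + x2 * M 2" for x0 x1 x2
    by (simp only: M_def Bochner_Integration.integral_add Bochner_Integration.integrable_add
        integrable_mult_right int integral_mult_right_zero)
  \<comment> \<open>The coefficients make \<open>d \<eta> + \<tau> \<eta>' = (\<tau> - \<xi>)\<^sup>2 + const\<close> and \<open>\<eta> L = 0\<close>; the assumption on \<open>\<xi>\<close> then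
    says that the other zero of \<open>\<eta>\<close> is not below \<open>L\<close>.\<close>
  define e0 where "e0 = 2 * \<xi> * L / (d + 1) - L\<^sup>2 / (d + 2)"
  define e1 where "e1 = - 2 * \<xi> / (d + 1)"
  define e2 where "e2 = 1 / (d + 2)"
  define \<eta> where "\<eta> t = e0 + e1 * t + e2 * t\<^sup>2" for t
  have eta_factor: "\<eta> t = (L - t) * (2 * \<xi> / (d + 1) - (L + t) / (d + 2))" for t
    unfolding \<eta>_def e0_def e1_def e2_def
    by (simp add: algebra_simps diff_divide_distrib add_divide_distrib power2_eq_square)
  have eta0: "0 \<le> \<eta> t" if "t \<le> L" for t
  proof -
    have "(L + t) / (d + 2) \<le> 2 * L / (d + 2)"
      using that d by (intro divide_right_mono) auto
    also have "\<dots> \<le> 2 * \<xi> / (d + 1)"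
      using xi d unfolding d_def[symmetric] by (simp add: field_simps)
    finally show ?thesis
      using that unfolding eta_factor by (intro mult_nonneg_nonneg) auto
  qed
  define P where "P c = e0 * M 0 * c ^ DIM('a) + e1 * M 1 * c ^ (DIM('a) + 1) + e2 * M 2 * c ^ (DIM('a) + 2)" for c
  have P_le: "P c \<le> P 1" if c: "0 < c" "c \<le> 1" for c
  proof -
    define Sc where "Sc = (\<lambda>w. p + (1 / c) *\<^sub>R (w - p)) -` S"
    have Sc[measurable]: "Sc \<in> sets borel"
      unfolding Sc_def
      by (rule measurable_sets_borel[OF _ S(1)]) measurable
    have sub: "Sc \<subseteq> S"
    proof
      fix w assume "w \<in> Sc"
      from star[OF this[unfolded Sc_def vimage_eq] c] show "w \<in> S"
        using c by (simp add: algebra_simps)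
    qed
    have bd: "integrable lborel (\<lambda>w. indicator A w * \<eta> (\<tau> w))" if "A \<subseteq> S" "A \<in> sets borel" for A
    proof -
      have "integrable lborel (\<lambda>w. indicator A w *\<^sub>R (e0 * (indicator S w * \<tau> w ^ 0) + e1 * (indicator S w * \<tau> w ^ 1) + e2 * (indicator S w * \<tau> w ^ 2)))"
        using that(2)
        by (intro integrable_mult_indicator Bochner_Integration.integrable_add integrable_mult_right int) simp
      also have "(\<lambda>w. indicator A w *\<^sub>R (e0 * (indicator S w * \<tau> w ^ 0) + e1 * (indicator S w * \<tau> w ^ 1) + e2 * (indicator S w * \<tau> w ^ 2)))
         = (\<lambda>w. indicator A w * \<eta> (\<tau> w))"
        using that(1) by (auto simp: fun_eq_iff \<eta>_def indicator_def)
      finally show ?thesis .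
    qed
    have "(LINT w|lborel. indicator Sc w * \<eta> (\<tau> w))
      = \<bar>c\<bar> ^ DIM('a) * (LINT w|lborel. indicator Sc ((p - c *\<^sub>R p) + c *\<^sub>R w) * \<eta> (\<tau> ((p - c *\<^sub>R p) + c *\<^sub>R w)))"
      using c by (intro integral_lborel_affine) (auto simp: \<eta>_def)
    also have "(\<lambda>w. indicator Sc ((p - c *\<^sub>R p) + c *\<^sub>R w) * \<eta> (\<tau> ((p - c *\<^sub>R p) + c *\<^sub>R w)))
      = (\<lambda>w. e0 * (indicator S w * \<tau> w ^ 0) + c * e1 * (indicator S w * \<tau> w ^ 1) + c\<^sup>2 * e2 * (indicator S w * \<tau> w ^ 2))"
    proof
      fix w
      have "\<tau> ((p - c *\<^sub>R p) + c *\<^sub>R w) = c * \<tau> w"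
        unfolding \<tau>_def by (simp add: algebra_simps)
      moreover have "(p - c *\<^sub>R p) + c *\<^sub>R w \<in> Sc \<longleftrightarrow> w \<in> S"
        unfolding Sc_def using c by (simp add: algebra_simps)
      ultimately show "indicator Sc ((p - c *\<^sub>R p) + c *\<^sub>R w) * \<eta> (\<tau> ((p - c *\<^sub>R p) + c *\<^sub>R w))
       = e0 * (indicator S w * \<tau> w ^ 0) + c * e1 * (indicator S w * \<tau> w ^ 1) + c\<^sup>2 * e2 * (indicator S w * \<tau> w ^ 2)"
        by (simp add: indicator_def \<eta>_def power_mult_distrib)
    qed
    also have "(LINT w|lborel. e0 * (indicator S w * \<tau> w ^ 0) + c * e1 * (indicator S w * \<tau> w ^ 1) + c\<^sup>2 * e2 * (indicator S w * \<tau> w ^ 2))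
      = e0 * M 0 + c * e1 * M 1 + c\<^sup>2 * e2 * M 2"
      by (rule lin)
    finally have "P c = (LINT w|lborel. indicator Sc w * \<eta> (\<tau> w))"
      using c by (simp add: P_def algebra_simps power_add power2_eq_square)
    also have "\<dots> \<le> (LINT w|lborel. indicator S w * \<eta> (\<tau> w))"
    proof (intro integral_mono bd sub Sc order_refl)
      fix w
      show "indicator Sc w * \<eta> (\<tau> w) \<le> indicator S w * \<eta> (\<tau> w)"
        using sub eta0[of "\<tau> w"] rng[of w] by (auto simp: indicator_def \<tau>_def)
    qed (use S(1) in auto)
    also have "(\<lambda>w. indicator S w * \<eta> (\<tau> w)) = (\<lambda>w. e0 * (indicator S w * \<tau> w ^ 0) + e1 * (indicator S w * \<tau> w ^ 1) + e2 * (indicator S w * \<tau> w ^ 2))"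
      by (auto simp: fun_eq_iff \<eta>_def indicator_def)
    also have "(LINT w|lborel. e0 * (indicator S w * \<tau> w ^ 0) + e1 * (indicator S w * \<tau> w ^ 1) + e2 * (indicator S w * \<tau> w ^ 2)) = P 1"
      unfolding lin by (simp add: P_def)
    finally show ?thesis .
  qed
  have DP: "(P has_real_derivative (d * e0 * M 0 + (d + 1) * e1 * M 1 + (d + 2) * e2 * M 2)) (at 1)"
    unfolding P_def by (auto intro!: derivative_eq_intros simp: d_def algebra_simps)
  have nonneg: "0 \<le> d * e0 * M 0 + (d + 1) * e1 * M 1 + (d + 2) * e2 * M 2"
  proof (rule ccontr)
    assume "\<not> ?thesis"
    then obtain h where h: "h > 0" "\<And>x. 0 < x \<Longrightarrow> x < h \<Longrightarrow> P 1 < P (1 - x)"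
      using DERIV_neg_dec_left[OF DP] by auto
    define x where "x = min (h / 2) (1 / 2)"
    have "P 1 < P (1 - x)" using h by (auto simp: x_def)
    moreover have "P (1 - x) \<le> P 1" using h by (intro P_le) (auto simp: x_def)
    ultimately show False by simp
  qed
  have "(LINT w:S|lborel. (u \<bullet> (w - p) - \<xi>)\<^sup>2)
    = (LINT w|lborel. \<xi>\<^sup>2 * (indicator S w * \<tau> w ^ 0) + (- 2 * \<xi>) * (indicator S w * \<tau> w ^ 1)
       + 1 * (indicator S w * \<tau> w ^ 2))"
    unfolding set_lebesgue_integral_def \<tau>_def[symmetric]
    by (intro Bochner_Integration.integral_cong) (auto simp: indicator_def power2_eq_square algebra_simps)
  also have "\<dots> = M 2 - 2 * \<xi> * M 1 + \<xi>\<^sup>2 * M 0"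
    unfolding lin by simp
  finally have I: "(LINT w:S|lborel. (u \<bullet> (w - p) - \<xi>)\<^sup>2) = M 2 - 2 * \<xi> * M 1 + \<xi>\<^sup>2 * M 0" .
  have M0: "M 0 = measure lborel S" unfolding M_def by simp
  have "(d + 1) * e1 = - 2 * \<xi>" "(d + 2) * e2 = 1"
    using d by (simp_all add: e1_def e2_def)
  with nonneg have "0 \<le> d * e0 * M 0 - 2 * \<xi> * M 1 + M 2" by simp
  moreover have "d * e0 = 2 * \<xi> * L * d / (d + 1) - L\<^sup>2 * d / (d + 2)"
    by (simp add: e0_def right_diff_distrib mult_ac)
  ultimately show ?thesis
    unfolding I M0[symmetric] d_def[symmetric] by (simp add: algebra_simps)
qed

text \<open>Cut \<open>W\<close> by a hyperplane \<open>u \<bullet> w = s0\<close>.  The lower part is star-shaped about \<open>q\<close> and the upper part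
  about \<open>p\<close>, so the previous lemma bounds the second moment of each by that of a cone.  The cutting
  level is chosen such that both cones have the same second moment about \<open>x\<close>; for \<open>x\<close> too close to
  the top, the whole of \<open>W\<close> is compared with one cone with apex \<open>q\<close>.\<close>
lemma second_moment_ge_width_right_of_centre:
  fixes W :: "'a::euclidean_space set" and u p q :: 'a and x :: real
  assumes W: "W \<in> sets borel" "bounded W" "convex W" and "p \<in> W" "q \<in> W"
    and pmax: "\<And>w. w \<in> W \<Longrightarrow> u \<bullet> w \<le> u \<bullet> p"
    and qmin: "\<And>w. w \<in> W \<Longrightarrow> u \<bullet> q \<le> u \<bullet> w"
    and x: "(u \<bullet> p + u \<bullet> q) / 2 \<le> x"
  shows "(u \<bullet> p - u \<bullet> q)\<^sup>2 / (2 * (real DIM('a) + 1) * (real DIM('a) + 2)) * measure lborel W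
    \<le> (LINT w:W|lborel. (u \<bullet> w - x)\<^sup>2)"
proof -
  define d where "d = real DIM('a)"
  have d: "d \<ge> 1" unfolding d_def by (simp add: Suc_leI)
  define a where "a = u \<bullet> p"
  define b where "b = u \<bullet> q"
  define \<theta> where "\<theta> = (a - b)\<^sup>2 / (2 * (d + 1) * (d + 2))"
  have ab: "b \<le> a" unfolding a_def b_def by (rule pmax) fact
  have [measurable]: "W \<in> sets borel" by fact
  \<comment> \<open>The mean of \<open>(\<tau> - \<xi>)\<^sup>2\<close> over a cone of height \<open>L\<close>, where \<open>\<tau>\<close> is the height above the apex.\<close>
  define D where "D \<xi> L = \<xi>\<^sup>2 - 2 * \<xi> * L * d / (d + 1) + L\<^sup>2 * d / (d + 2)" for \<xi> L
  have star: "r + c *\<^sub>R (w - r) \<in> W" if "r \<in> W" "w \<in> W" "0 < c" "c \<le> 1" for r w c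
    using that convexD_alt[OF W(3) that(1,2), of c] by (simp add: algebra_simps)
  define A where "A s0 = {w \<in> W. u \<bullet> w \<le> s0}" for s0
  define B where "B s0 = {w \<in> W. s0 < u \<bullet> w}" for s0
  have mono: "c * t \<le> t" if "0 \<le> t" "c \<le> 1" for c t :: real
    using mult_left_le_one_le[of t c] that by (cases "0 \<le> c") (auto simp: mult_nonpos_nonneg order_trans[OF mult_nonpos_nonneg])
  have left: "D (x - b) (s0 - b) * measure lborel (A s0) \<le> (LINT w:A s0|lborel. (u \<bullet> w - x)\<^sup>2)"
    if "(s0 - b) * (d + 1) / (d + 2) \<le> x - b" for s0
  proof -
    have "((x - b)\<^sup>2 - 2 * (x - b) * (s0 - b) * real DIM('a) / (real DIM('a) + 1) + (s0 - b)\<^sup>2 * real DIM('a) / (real DIM('a) + 2)) * measure lborel (A s0)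
      \<le> (LINT w:A s0|lborel. (u \<bullet> (w - q) - (x - b))\<^sup>2)"
    proof (rule star_shaped_second_moment)
      show "A s0 \<in> sets borel" "bounded (A s0)"
        unfolding A_def using W(2) by (auto intro: bounded_subset)
    next
      fix w and c :: real assume w: "w \<in> A s0" and c: "0 < c" "c \<le> 1"
      have "u \<bullet> (q + c *\<^sub>R (w - q)) = u \<bullet> q + c * (u \<bullet> w - u \<bullet> q)"
        by (simp add: algebra_simps)
      also have "\<dots> \<le> u \<bullet> w" using mono[of "u \<bullet> w - u \<bullet> q" c] qmin[of w] w c by (auto simp: A_def)
      finally show "q + c *\<^sub>R (w - q) \<in> A s0"
        using star[OF \<open>q \<in> W\<close>, of w c] w c by (auto simp: A_def)
    next
      fix w assume "w \<in> A s0"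
      then show "0 \<le> u \<bullet> (w - q) \<and> u \<bullet> (w - q) \<le> s0 - b"
        using qmin[of w] by (auto simp: A_def b_def inner_diff_right)
    qed (use that in \<open>simp add: d_def\<close>)
    then show ?thesis
      by (simp add: D_def d_def b_def inner_diff_right add.commute)
  qed
  have right: "D (a - x) (a - s0) * measure lborel (B s0) \<le> (LINT w:B s0|lborel. (u \<bullet> w - x)\<^sup>2)"
    if "(a - s0) * (d + 1) / (d + 2) \<le> a - x" for s0
  proof -
    have "((a - x)\<^sup>2 - 2 * (a - x) * (a - s0) * real DIM('a) / (real DIM('a) + 1) + (a - s0)\<^sup>2 * real DIM('a) / (real DIM('a) + 2)) * measure lborel (B s0)
      \<le> (LINT w:B s0|lborel. ((- u) \<bullet> (w - p) - (a - x))\<^sup>2)"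
    proof (rule star_shaped_second_moment)
      show "B s0 \<in> sets borel" "bounded (B s0)"
        unfolding B_def using W(2) by (auto intro: bounded_subset)
    next
      fix w and c :: real assume w: "w \<in> B s0" and c: "0 < c" "c \<le> 1"
      have "u \<bullet> w \<le> u \<bullet> p - c * (u \<bullet> p - u \<bullet> w)" using mono[of "u \<bullet> p - u \<bullet> w" c] pmax[of w] w c by (auto simp: B_def)
      also have "\<dots> = u \<bullet> (p + c *\<^sub>R (w - p))"
        by (simp add: algebra_simps)
      finally show "p + c *\<^sub>R (w - p) \<in> B s0"
        using star[OF \<open>p \<in> W\<close>, of w c] w c by (auto simp: B_def)
    next
      fix w assume "w \<in> B s0"
      then show "0 \<le> (- u) \<bullet> (w - p) \<and> (- u) \<bullet> (w - p) \<le> a - s0"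
        using pmax[of w] by (auto simp: B_def a_def inner_diff_right)
    qed (use that in \<open>simp add: d_def\<close>)
    then show ?thesis
      by (simp add: D_def d_def a_def inner_diff_right power2_commute add.commute)
  qed
  have AB: "A s0 \<in> sets borel" "B s0 \<in> sets borel" for s0
    unfolding A_def B_def by auto
  have fin: "emeasure lborel W < \<infinity>"
    using emeasure_bounded_finite[OF W(2)] by simp
  have intW: "set_integrable lborel W (\<lambda>w. (u \<bullet> w - x)\<^sup>2)"
    unfolding set_integrable_def
  proof (rule integrableI_bounded_set[where A=W and B="(\<bar>a\<bar> + \<bar>b\<bar> + \<bar>x\<bar>)\<^sup>2"])
    show "AE w in lborel. w \<in> W \<longrightarrow> norm (indicator W w *\<^sub>R (u \<bullet> w - x)\<^sup>2) \<le> (\<bar>a\<bar> + \<bar>b\<bar> + \<bar>x\<bar>)\<^sup>2"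
    proof (rule AE_I2, rule impI)
      fix w assume "w \<in> W"
      then have "\<bar>u \<bullet> w - x\<bar> \<le> \<bar>\<bar>a\<bar> + \<bar>b\<bar> + \<bar>x\<bar>\<bar>"
        using pmax[of w] qmin[of w] unfolding a_def b_def by linarith
      then show "norm (indicator W w *\<^sub>R (u \<bullet> w - x)\<^sup>2) \<le> (\<bar>a\<bar> + \<bar>b\<bar> + \<bar>x\<bar>)\<^sup>2"
        using \<open>w \<in> W\<close> by (simp flip: abs_le_square_iff)
    qed
  qed (use fin in auto)
  have WAB: "W = A s0 \<union> B s0" "A s0 \<inter> B s0 = {}" for s0
    unfolding A_def B_def by auto
  have split: "(LINT w:W|lborel. (u \<bullet> w - x)\<^sup>2) = (LINT w:A s0|lborel. (u \<bullet> w - x)\<^sup>2) + (LINT w:B s0|lborel. (u \<bullet> w - x)\<^sup>2)" for s0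
    by (subst WAB(1)[of s0], rule set_integral_Un[OF WAB(2)])
      (rule set_integrable_subset[OF intW]; use AB WAB in auto)+
  have msplit: "measure lborel W = measure lborel (A s0) + measure lborel (B s0)" for s0
  proof -
    have "emeasure lborel (A s0) \<noteq> \<infinity>" "emeasure lborel (B s0) \<noteq> \<infinity>"
      using emeasure_bounded_finite[of "A s0"] emeasure_bounded_finite[of "B s0"]
        bounded_subset[OF W(2), of "A s0"] bounded_subset[OF W(2), of "B s0"]
      by (auto simp: A_def B_def)
    then show ?thesis
      using AB WAB(2) by (subst WAB(1)[of s0], intro measure_Union) auto
  qed
  have "\<theta> * measure lborel W \<le> (LINT w:W|lborel. (u \<bullet> w - x)\<^sup>2)"
  proof -
    have "\<bar>x - (a + b) / 2\<bar> = x - (a + b) / 2"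
      using x by (simp add: a_def b_def)
    then consider "\<bar>x - (a + b) / 2\<bar> \<le> (a - b) * d / (2 * (d + 2))"
      | "x > (a + b) / 2 + (a - b) * d / (2 * (d + 2))"
      by linarith
    then show ?thesis
    proof cases
      case 1
      \<comment> \<open>The two values of \<open>D\<close> below agree if \<open>s0 - x = 2 * (s0 - (a + b) / 2) / (d + 2)\<close>;
        \<open>\<delta>\<close> is twice the offset of this \<open>s0\<close> from the midpoint \<open>(a + b) / 2\<close>.\<close>
      define \<delta> where "\<delta> = (d + 2) * (2 * ((x - (a + b) / 2) / d))"
      define s0 where "s0 = (a + b) / 2 + \<delta> / 2"
      have xd: "x = s0 - \<delta> / (d + 2)"
      proof -
        define Y where "Y = (x - (a + b) / 2) / d"
        have \<delta>Y: "\<delta> = (d + 2) * (2 * Y)" unfolding \<delta>_def Y_def by (rule refl)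
        have "\<delta> / (d + 2) = 2 * Y"
          unfolding \<delta>Y using d by (intro nonzero_mult_div_cancel_left) simp
        moreover have "\<delta> / 2 = d * Y + 2 * Y"
          unfolding \<delta>Y by (simp add: algebra_simps)
        moreover have "d * Y = x - (a + b) / 2"
          using d by (simp add: Y_def)
        ultimately show ?thesis unfolding s0_def by linarith
      qed
      define Z where "Z = x - (a + b) / 2"
      have "\<bar>\<delta>\<bar> = \<bar>Z\<bar> * (2 * (d + 2) / d)"
        using d unfolding \<delta>_def Z_def[symmetric] by (simp add: abs_mult)
      also have "\<dots> \<le> (a - b) * d / (2 * (d + 2)) * (2 * (d + 2) / d)"
        using 1 d unfolding Z_def[symmetric] by (intro mult_right_mono) auto
      also have "\<dots> = a - b" using d by simp
      finally have \<delta>: "\<bar>\<delta>\<bar> \<le> a - b" .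
      have shrink: "t * (d + 1) / (d + 2) = t - t / (d + 2)" for t
        using d by (simp add: field_simps)
      have "\<delta> \<le> s0 - b" "- \<delta> \<le> a - s0"
        using \<delta> by (auto simp: s0_def field_simps)
      then have "\<delta> / (d + 2) \<le> (s0 - b) / (d + 2)" "- \<delta> / (d + 2) \<le> (a - s0) / (d + 2)"
        using d by (auto intro!: divide_right_mono simp del: divide_minus_left)
      then have L: "(s0 - b) * (d + 1) / (d + 2) \<le> x - b"
        and R: "(a - s0) * (d + 1) / (d + 2) \<le> a - x"
        unfolding shrink using xd by auto
      have D_split: "D ((t + e) / 2 - e / (d + 2)) ((t + e) / 2)
          = t\<^sup>2 / (2 * (d + 1) * (d + 2)) + e\<^sup>2 * (1 / (d + 2)\<^sup>2 - 1 / (2 * (d + 1) * (d + 2)))" for t e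
      proof -
        define i j where "i = 1 / (d + 1)" and "j = 1 / (d + 2)"
        have ij: "(d + 1) * i = 1" "(d + 2) * j = 1"
          using d by (auto simp: i_def j_def)
        define h where "h = (t + e) / 2"
        have dij: "d * i = 1 - i" "d * j = 1 - 2 * j" "i - j = i * j"
          using ij by algebra+
        have "(h - e * j)\<^sup>2 - 2 * (h - e * j) * h * d * i + h\<^sup>2 * d * j
            = (h - e * j)\<^sup>2 - 2 * (h - e * j) * h * (1 - i) + h\<^sup>2 * (1 - 2 * j)"
          by (simp add: mult.assoc dij)
        also have "\<dots> = 2 * h\<^sup>2 * (i - j) - 2 * h * e * (i * j) + e\<^sup>2 * j\<^sup>2"
          by (simp add: power2_eq_square algebra_simps)
        also have "\<dots> = 2 * h * (h - e) * (i * j) + e\<^sup>2 * j\<^sup>2"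
          unfolding dij(3) by (simp add: power2_eq_square algebra_simps)
        also have "2 * h * (h - e) = (t\<^sup>2 - e\<^sup>2) / 2"
          by (simp add: h_def power2_eq_square field_simps)
        finally have Q: "((t + e) / 2 - e * j)\<^sup>2 - 2 * ((t + e) / 2 - e * j) * ((t + e) / 2) * d * i
            + ((t + e) / 2)\<^sup>2 * d * j = t\<^sup>2 * (i * j / 2) + e\<^sup>2 * (j\<^sup>2 - i * j / 2)"
          by (simp add: h_def field_simps)
        have q: "z / (d + 1) = z * i" "z / (d + 2) = z * j" "z / (2 * (d + 1) * (d + 2)) = z * (i * j / 2)"
          "1 / (d + 2)\<^sup>2 = j\<^sup>2" for z
          by (simp_all add: i_def j_def power_divide mult_ac del: distrib_left_numeral)
        show ?thesis
          unfolding D_def q using Q by simp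
      qed
      have "s0 - b = (a - b + \<delta>) / 2" "x - b = (a - b + \<delta>) / 2 - \<delta> / (d + 2)"
        using xd by (auto simp: s0_def field_simps)
      then have DL: "D (x - b) (s0 - b) = \<theta> + \<delta>\<^sup>2 * (1 / (d + 2)\<^sup>2 - 1 / (2 * (d + 1) * (d + 2)))"
        using D_split[of "a - b" \<delta>] by (simp only: \<theta>_def)
      have "a - s0 = (a - b + - \<delta>) / 2" "a - x = (a - b + - \<delta>) / 2 - (- \<delta>) / (d + 2)"
        using xd by (auto simp: s0_def field_simps)
      then have DR: "D (a - x) (a - s0) = \<theta> + \<delta>\<^sup>2 * (1 / (d + 2)\<^sup>2 - 1 / (2 * (d + 1) * (d + 2)))"
        using D_split[of "a - b" "- \<delta>"] by (simp only: \<theta>_def power2_minus)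
      have "1 / (2 * (d + 1) * (d + 2)) \<le> 1 / (d + 2)\<^sup>2"
        using d by (intro divide_left_mono) (auto simp: power2_eq_square intro!: mult_right_mono)
      then have ge: "\<theta> \<le> \<theta> + \<delta>\<^sup>2 * (1 / (d + 2)\<^sup>2 - 1 / (2 * (d + 1) * (d + 2)))" by simp
      show ?thesis
        unfolding split[of s0] msplit[of s0] distrib_left
        using left[OF L] right[OF R] ge unfolding DL DR
        by (intro add_mono) (erule order_trans[rotated], rule mult_right_mono, auto)+
    next
      case 2
      have x: "(a - b) * (d + 1) / (d + 2) \<le> x - b"
        using 2 d by (simp add: field_simps)
      have ge: "\<theta> \<le> D (x - b) (a - b)"
      proof -
        define i j where "i = 1 / (d + 1)" and "j = 1 / (d + 2)"
        have ij: "(d + 1) * i = 1" "(d + 2) * j = 1"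
          using d by (auto simp: i_def j_def)
        have Q: "(x - b)\<^sup>2 - 2 * (x - b) * (a - b) * d * i + (a - b)\<^sup>2 * d * j
            = (a - b)\<^sup>2 * (i * j / 2) + (x - b - (a - b) * d * i)\<^sup>2
              + (a - b)\<^sup>2 * ((d - 1) * (i\<^sup>2 * j / 2))"
          using ij by algebra
        have q: "z / (d + 1) = z * i" "z / (d + 2) = z * j" "z / (2 * (d + 1) * (d + 2)) = z * (i * j / 2)"
          "1 / (d + 2)\<^sup>2 = j\<^sup>2" for z
          by (simp_all add: i_def j_def power_divide mult_ac del: distrib_left_numeral)
        have "0 \<le> (a - b)\<^sup>2 * ((d - 1) * (i\<^sup>2 * j / 2))"
          using d by (simp add: j_def)
        then show ?thesis
          unfolding D_def \<theta>_def q using Q by simp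
      qed
      have "A a = W" unfolding A_def a_def using pmax by auto
      then show ?thesis using left[OF x] mult_right_mono[OF ge, of "measure lborel W"] by simp
    qed
  qed
  then show ?thesis unfolding \<theta>_def a_def b_def d_def by simp
qed

text \<open>The constant is attained by double cones that are symmetric about the hyperplane of their
  common base, with \<open>x\<close> the level of that hyperplane.\<close>
lemma second_moment_ge_width:
  fixes W :: "'a::euclidean_space set" and u p q :: 'a and x :: real
  assumes W: "W \<in> sets borel" "bounded W" "convex W" and pq: "p \<in> W" "q \<in> W"
    and pmax: "\<And>w. w \<in> W \<Longrightarrow> u \<bullet> w \<le> u \<bullet> p"
    and qmin: "\<And>w. w \<in> W \<Longrightarrow> u \<bullet> q \<le> u \<bullet> w"
  shows "(u \<bullet> p - u \<bullet> q)\<^sup>2 / (2 * (real DIM('a) + 1) * (real DIM('a) + 2)) * measure lborel W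
    \<le> (LINT w:W|lborel. (u \<bullet> w - x)\<^sup>2)"
proof (cases "(u \<bullet> p + u \<bullet> q) / 2 \<le> x")
  case True
  then show ?thesis using assms by (intro second_moment_ge_width_right_of_centre)
next
  case False
  have "((- u) \<bullet> q - (- u) \<bullet> p)\<^sup>2 / (2 * (real DIM('a) + 1) * (real DIM('a) + 2)) * measure lborel W
    \<le> (LINT w:W|lborel. ((- u) \<bullet> w - (- x))\<^sup>2)"
    using False W pq by (intro second_moment_ge_width_right_of_centre) (auto simp: pmax qmin)
  moreover have "((- u) \<bullet> q - (- u) \<bullet> p)\<^sup>2 = (u \<bullet> p - u \<bullet> q)\<^sup>2"
    "((- u) \<bullet> w - (- x))\<^sup>2 = (u \<bullet> w - x)\<^sup>2" for w
    by (simp_all add: power2_commute)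
  ultimately show ?thesis by simp
qed

section \<open>The gauge of a polar body and its exponential moments\<close>

text \<open>The polar with respect to \<open>y\<close> is \<open>{y + w | w. polar_gauge K y w \<le> 1}\<close>.  The gauge is the support
  function of \<open>K\<close>, reflected and relative to the origin \<open>y\<close>.\<close>
definition polar_gauge :: "'a::euclidean_space set \<Rightarrow> 'a \<Rightarrow> 'a \<Rightarrow> real" where
  "polar_gauge K y w = (SUP z\<in>K. w \<bullet> (y - z))"

text \<open>Up to a factorial, the \<open>k\<close>-th moment in direction \<open>u\<close> of the polar moved by \<open>- y\<close>.  The form as an integral
  over the whole space makes the dependence on \<open>y\<close> smooth and explicit.\<close>
definition polar_moment :: "'a::euclidean_space set \<Rightarrow> 'a \<Rightarrow> nat \<Rightarrow> 'a \<Rightarrow> real" where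
  "polar_moment K u k y = (LINT w|lborel. (u \<bullet> w) ^ k * exp (- polar_gauge K y w))"

lemma polar_gauge_bdd:
  fixes K :: "'a::euclidean_space set"
  assumes "compact K"
  shows "bdd_above ((\<lambda>z. w \<bullet> (y - z)) ` K)"
  using assms
  by (intro bounded_imp_bdd_above compact_imp_bounded compact_continuous_image continuous_intros)

lemma polar_gauge_le_iff:
  assumes "compact K" "K \<noteq> {}"
  shows "polar_gauge K y w \<le> c \<longleftrightarrow> (\<forall>z\<in>K. w \<bullet> (y - z) \<le> c)"
  unfolding polar_gauge_def using assms by (intro cSUP_le_iff polar_gauge_bdd)

lemma polar_gauge_ge:
  assumes "compact K" "z \<in> K"
  shows "w \<bullet> (y - z) \<le> polar_gauge K y w"
  unfolding polar_gauge_def using assms by (intro cSUP_upper polar_gauge_bdd)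

text \<open>This linear dependence on the centre of polarity turns the moments into Laplace transforms.\<close>
lemma polar_gauge_translate:
  assumes "compact K" "K \<noteq> {}"
  shows "polar_gauge K (y + h) w = polar_gauge K y w + w \<bullet> h"
proof (rule antisym)
  show "polar_gauge K (y + h) w \<le> polar_gauge K y w + w \<bullet> h"
    using polar_gauge_ge[OF assms(1), of _ w y]
    by (auto simp: polar_gauge_le_iff[OF assms] inner_diff_right inner_add_right)
  have "polar_gauge K y w \<le> polar_gauge K (y + h) w - w \<bullet> h"
    using polar_gauge_ge[OF assms(1), of _ w "y + h"]
    by (fastforce simp: polar_gauge_le_iff[OF assms] inner_diff_right inner_add_right)
  then show "polar_gauge K y w + w \<bullet> h \<le> polar_gauge K (y + h) w" by simp
qed

lemma polar_gauge_scale: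
  assumes K: "compact K" "K \<noteq> {}" and "0 < c"
  shows "polar_gauge K y (c *\<^sub>R w) = c * polar_gauge K y w"
proof -
  have le: "polar_gauge K y (c *\<^sub>R w) \<le> c * polar_gauge K y w" if "0 < c" for c w
    using polar_gauge_ge[OF K(1), of _ w y] that by (auto simp: polar_gauge_le_iff[OF K])
  have "polar_gauge K y ((1 / c) *\<^sub>R (c *\<^sub>R w)) \<le> 1 / c * polar_gauge K y (c *\<^sub>R w)"
    using \<open>0 < c\<close> by (intro le) auto
  then have "c * polar_gauge K y w \<le> polar_gauge K y (c *\<^sub>R w)"
    using \<open>0 < c\<close> by (simp add: field_simps)
  then show ?thesis using le[OF \<open>0 < c\<close>, of w] by simp
qed

lemma convex_on_polar_gauge:
  assumes K: "compact K" "K \<noteq> {}"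
  shows "convex_on UNIV (polar_gauge K y)"
proof (rule convex_onI)
  fix t :: real and v w :: 'a assume t: "0 < t" "t < 1"
  show "polar_gauge K y ((1 - t) *\<^sub>R v + t *\<^sub>R w) \<le> (1 - t) * polar_gauge K y v + t * polar_gauge K y w"
    unfolding polar_gauge_le_iff[OF K]
  proof
    fix z assume "z \<in> K"
    then show "((1 - t) *\<^sub>R v + t *\<^sub>R w) \<bullet> (y - z) \<le> (1 - t) * polar_gauge K y v + t * polar_gauge K y w"
      using t polar_gauge_ge[OF K(1), of z v y] polar_gauge_ge[OF K(1), of z w y]
      unfolding inner_add_left inner_scaleR_left by (intro add_mono mult_left_mono) auto
  qed
qed simp

lemma continuous_on_polar_gauge:
  assumes "compact K" "K \<noteq> {}"
  shows "continuous_on UNIV (polar_gauge K y)"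
  using convex_on_polar_gauge[OF assms] by (intro convex_on_continuous) auto

lemma polar_gauge_ge_norm:
  assumes K: "compact K" and "cball y r \<subseteq> K" "0 \<le> r"
  shows "r * norm w \<le> polar_gauge K y w"
proof (cases "w = 0")
  case True
  have "y \<in> K" using assms by auto
  then show ?thesis using polar_gauge_ge[OF K, of y w y] True by simp
next
  case False
  have "y - (r / norm w) *\<^sub>R w \<in> K"
    using assms False by (intro subsetD[OF assms(2)]) (auto simp: dist_norm)
  from polar_gauge_ge[OF K this, of w y] show ?thesis
    using False by (simp add: dot_square_norm power2_eq_square)
qed

locale interior_point =
  fixes K :: "'a::euclidean_space set" and y :: 'a
  assumes K: "compact K" and mem: "y \<in> interior K"
begin

lemma ne: "K \<noteq> {}" using mem interior_subset by auto

abbreviation "W \<equiv> {w. polar_gauge K y w \<le> 1}"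

lemma ge_norm: "\<exists>r>0. \<forall>w. r * norm w \<le> polar_gauge K y w"
proof -
  obtain r where "0 < r" "cball y r \<subseteq> K" using mem unfolding mem_interior_cball by blast
  then show ?thesis using polar_gauge_ge_norm[OF K, of y r] by auto
qed

lemma nonneg: "0 \<le> polar_gauge K y w"
  using polar_gauge_ge[OF K, of y w y] mem interior_subset[of K] by auto

lemma measurable_gauge[measurable]: "polar_gauge K y \<in> borel_measurable borel"
  by (rule borel_measurable_continuous_onI[OF continuous_on_polar_gauge[OF K ne]])

lemma compact_W: "compact W"
proof -
  obtain r where r: "0 < r" "\<And>w. r * norm w \<le> polar_gauge K y w" using ge_norm by blast
  have "norm w \<le> 1 / r" if "w \<in> W" for w
    using order_trans[OF r(2)[of w]] that r(1) by (simp add: field_simps)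
  then have "bounded W" unfolding bounded_iff by blast
  moreover have "closed W"
    by (intro closed_Collect_le continuous_on_polar_gauge[OF K ne] continuous_intros)
  ultimately show ?thesis by (simp add: compact_eq_bounded_closed)
qed

lemma convex_W: "convex W"
proof -
  have "W = (\<Inter>z\<in>K. {w. (y - z) \<bullet> w \<le> 1})"
    by (simp add: polar_gauge_le_iff[OF K ne] inner_commute set_eq_iff)
  then show ?thesis by (simp add: convex_INT convex_halfspace_le)
qed

lemma ball_subset_W:
  assumes "0 < R" "\<And>z. z \<in> K \<Longrightarrow> dist y z \<le> R"
  shows "cball 0 (1 / R) \<subseteq> W"
proof
  fix w :: 'a assume w: "w \<in> cball 0 (1 / R)"
  have "w \<bullet> (y - z) \<le> 1" if "z \<in> K" for z
  proof -
    have "w \<bullet> (y - z) \<le> norm w * norm (y - z)" by (rule norm_cauchy_schwarz)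
    also have "\<dots> \<le> 1 / R * R"
      using w assms that by (intro mult_mono) (auto simp: dist_norm)
    finally show ?thesis using assms by simp
  qed
  then show "w \<in> W" by (simp add: polar_gauge_le_iff[OF K ne])
qed

lemma measure_W: "0 < measure lborel W" "emeasure lborel W < \<infinity>"
proof -
  obtain R where R: "0 < R" "\<And>z. z \<in> K \<Longrightarrow> norm (y - z) \<le> R"
    using compact_imp_bounded[OF compact_translation[OF compact_negations[OF K], of y]]
    unfolding bounded_pos by (auto simp: image_image)
  have sub: "cball 0 (1 / R) \<subseteq> W"
    using R by (intro ball_subset_W) (auto simp: dist_norm)
  show fin: "emeasure lborel W < \<infinity>"
    using emeasure_bounded_finite[OF compact_imp_bounded[OF compact_W]] by simp
  have "0 < measure lborel (cball (0::'a) (1 / R))"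
    using R(1) content_cball_pos[of "1 / R" 0] by simp
  also have "\<dots> \<le> measure lborel W"
    using sub fin by (intro measure_mono_fmeasurable fmeasurableI) auto
  finally show "0 < measure lborel W" .
qed

lemma set_integrable_W: "continuous_on UNIV f \<Longrightarrow> set_integrable lborel W (f :: 'a \<Rightarrow> real)"
  unfolding set_integrable_def
  by (rule borel_integrable_compact[OF compact_W]) (erule continuous_on_subset, simp)

lemma moment_integrable: "integrable lborel (\<lambda>w. (u \<bullet> w) ^ k * exp (- polar_gauge K y w))"
  and moment_eq: "polar_moment K u k y = fact (DIM('a) + k) * (LINT w:W|lborel. (u \<bullet> w) ^ k)"
proof -
  have "(\<lambda>w. (u \<bullet> w) ^ k) \<in> borel_measurable borel" by measurable
  note hom = integral_homogeneous_exp[OF this measurable_gauge nonneg, of k]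
  have "set_integrable lborel W (\<lambda>w. (u \<bullet> w) ^ k)"
    by (intro set_integrable_W continuous_intros)
  note hom = hom[OF _ polar_gauge_scale[OF K ne] this]
  show "integrable lborel (\<lambda>w. (u \<bullet> w) ^ k * exp (- polar_gauge K y w))"
    by (rule hom(1)) (simp_all add: power_mult_distrib)
  show "polar_moment K u k y = fact (DIM('a) + k) * (LINT w:W|lborel. (u \<bullet> w) ^ k)"
    unfolding polar_moment_def by (rule hom(2)) (simp_all add: power_mult_distrib)
qed

lemma moment_0: "polar_moment K u 0 y = fact DIM('a) * measure lborel W"
  unfolding moment_eq by (simp add: set_lebesgue_integral_def)

lemma moment_0_pos: "0 < polar_moment K u 0 y"
  unfolding moment_0 using measure_W by simp

end

lemma polar_wrt_eq:
  assumes "compact K" "K \<noteq> {}"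
  shows "polar_wrt y K = (+) y ` {w. polar_gauge K y w \<le> 1}"
proof -
  have "x \<in> polar_wrt y K \<longleftrightarrow> polar_gauge K y (x - y) \<le> 1" for x
    unfolding polar_wrt_def polar_gauge_le_iff[OF assms] mem_Collect_eq
    by (intro ball_cong refl) (auto simp: inner_diff_right)
  moreover have "x \<in> (+) y ` {w. polar_gauge K y w \<le> 1} \<longleftrightarrow> polar_gauge K y (x - y) \<le> 1" for x
    by (auto simp: image_iff intro!: exI[of _ "x - y"])
  ultimately show ?thesis by auto
qed

lemma centroid_translate_inner:
  fixes W :: "(real ^ 'n) set"
  assumes W: "compact W" and pos: "0 < measure lborel W"
  shows "(centroid ((+) y ` W) - y) \<bullet> u = (LINT w:W|lborel. u \<bullet> w) / measure lborel W"
proof -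
  let ?W = "(+) y ` W"
  have cW: "compact ?W" by (rule compact_translation[OF W])
  have [measurable]: "W \<in> sets borel" "?W \<in> sets borel"
    using W cW by (auto intro: borel_compact)
  have ind: "indicator ?W (y + w) = (indicator W w :: real)" for w
    by (auto simp: indicator_def)
  have m: "measure lborel ?W = measure lborel W"
  proof -
    have "(LINT x|lborel. indicator ?W x :: real) = (LINT x|lborel. indicator W x)"
      by (subst integral_lborel_affine[where c=1 and t=y]) (auto simp: ind)
    then show ?thesis by simp
  qed
  have "(centroid ?W) \<bullet> u = 1 / measure lborel ?W * ((LINT x|lborel. indicator ?W x *\<^sub>R x) \<bullet> u)"
    by (simp add: centroid_def set_lebesgue_integral_def)
  also have "(LINT x|lborel. indicator ?W x *\<^sub>R x) \<bullet> u = (LINT x|lborel. (indicator ?W x *\<^sub>R x) \<bullet> u)"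
    by (intro integral_inner_left[symmetric] impI borel_integrable_compact cW continuous_on_id)
  also have "\<dots> = (LINT w|lborel. indicator W w * (u \<bullet> y) + indicator W w * (u \<bullet> w))"
  proof -
    have "(\<lambda>x. (indicator ?W x *\<^sub>R x) \<bullet> u) \<in> borel_measurable borel" by measurable
    from integral_lborel_affine[OF this, of 1 y] show ?thesis
      by (simp add: ind inner_add_right inner_commute distrib_left)
  qed
  also have "\<dots> = measure lborel W * (u \<bullet> y) + (LINT w:W|lborel. u \<bullet> w)"
  proof -
    have "integrable lborel (\<lambda>w. indicator W w *\<^sub>R (u \<bullet> w))"
      "integrable lborel (\<lambda>w. indicator W w *\<^sub>R (u \<bullet> y))"
      by (intro borel_integrable_compact W continuous_intros)+
    then show ?thesis
      by (subst Bochner_Integration.integral_add) (auto simp: set_lebesgue_integral_def)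
  qed
  finally show ?thesis
    using pos unfolding m by (simp add: inner_diff_left inner_diff_right field_simps inner_commute)
qed

lemma centroid_polar_eq_moments:
  fixes K :: "(real ^ 'n) set"
  assumes "compact K" "y \<in> interior K"
  shows "(real CARD('n) + 1) * ((centroid (polar_wrt y K) - y) \<bullet> u)
    = polar_moment K u 1 y / polar_moment K u 0 y"
proof -
  interpret interior_point K y by unfold_locales fact+
  show ?thesis
    unfolding polar_wrt_eq[OF K ne] centroid_translate_inner[OF compact_W measure_W(1)]
      moment_0 moment_eq[of u 1] by (simp add: add.commute)
qed

text \<open>The polar of the ball, moved by \<open>- y\<close>, is \<open>{w. |w| \<le> 1 - y \<bullet> w}\<close>.  Squaring is harmless: for \<open>|y| < 1\<close> the number
  \<open>y \<bullet> w - 1\<close> is always less than \<open>|w|\<close>.  The result displays an ellipsoid.\<close>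
lemma mem_polar_gauge_cball:
  fixes y w :: "'a::euclidean_space"
  assumes "norm y < 1"
  shows "polar_gauge (cball 0 1) y w \<le> 1 \<longleftrightarrow> w \<bullet> w - (y \<bullet> w)\<^sup>2 + 2 * (y \<bullet> w) \<le> 1"
proof -
  have "polar_gauge (cball 0 1) y w \<le> 1 \<longleftrightarrow> norm w \<le> 1 - y \<bullet> w"
  proof -
    have "(\<forall>z\<in>cball 0 1. w \<bullet> (y - z) \<le> 1) \<longleftrightarrow> norm w \<le> 1 - y \<bullet> w"
    proof (intro iffI ballI)
      assume *: "\<forall>z\<in>cball 0 1. w \<bullet> (y - z) \<le> 1"
      show "norm w \<le> 1 - y \<bullet> w"
      proof (cases "w = 0")
        case False
        then have "- (1 / norm w) *\<^sub>R w \<in> cball 0 1" by simp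
        from *[rule_format, OF this] False show ?thesis
          by (simp add: inner_diff_right inner_add_right dot_square_norm power2_eq_square inner_commute)
      qed simp
    next
      fix z :: 'a assume *: "norm w \<le> 1 - y \<bullet> w" and "z \<in> cball 0 1"
      then have "\<bar>w \<bullet> z\<bar> \<le> norm w * 1"
        by (intro order_trans[OF Cauchy_Schwarz_ineq2] mult_left_mono) auto
      with * show "w \<bullet> (y - z) \<le> 1" by (simp add: inner_diff_right inner_commute)
    qed
    then show ?thesis by (subst polar_gauge_le_iff) auto
  qed
  also have "\<dots> \<longleftrightarrow> (norm w)\<^sup>2 \<le> (1 - y \<bullet> w)\<^sup>2"
  proof
    assume "norm w \<le> 1 - y \<bullet> w"
    then show "(norm w)\<^sup>2 \<le> (1 - y \<bullet> w)\<^sup>2" by (intro power_mono) auto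
  next
    assume "(norm w)\<^sup>2 \<le> (1 - y \<bullet> w)\<^sup>2"
    then have *: "norm w \<le> \<bar>1 - y \<bullet> w\<bar>" using abs_le_square_iff[of "norm w" "1 - y \<bullet> w"] by simp
    have "y \<bullet> w \<le> norm y * norm w" by (rule norm_cauchy_schwarz)
    also have "\<dots> \<le> 1 * norm w" using assms by (intro mult_right_mono) auto
    finally show "norm w \<le> 1 - y \<bullet> w" using * by (auto simp: abs_if split: if_splits)
  qed
  also have "\<dots> \<longleftrightarrow> w \<bullet> w - (y \<bullet> w)\<^sup>2 + 2 * (y \<bullet> w) \<le> 1"
    unfolding power2_norm_eq_inner by (auto simp: power2_eq_square algebra_simps)
  finally show ?thesis .
qed

text \<open>The quadratic form of the ellipsoid is invariant under \<open>w \<mapsto> c - w\<close> with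
  \<open>c = - 2 y / (1 - |y|\<^sup>2)\<close>, so its centroid is \<open>c / 2\<close>.\<close>
lemma centroid_polar_cball:
  fixes y :: "real ^ 'n"
  assumes y: "norm y < 1"
  shows "centroid (polar_wrt y (cball 0 1)) - y = - (1 / (1 - (norm y)\<^sup>2)) *\<^sub>R y"
proof -
  interpret interior_point "cball 0 1" y
    by unfold_locales (use y in \<open>auto simp: interior_cball\<close>)
  define \<kappa> where "\<kappa> = 1 / (1 - (norm y)\<^sup>2)"
  have "(norm y)\<^sup>2 < 1" using y by (simp add: abs_square_less_1)
  then have \<kappa>: "\<kappa> * (1 - y \<bullet> y) = 1" by (simp add: \<kappa>_def power2_norm_eq_inner)
  define c where "c = - (2 * \<kappa>) *\<^sub>R y"
  have sym: "c + (- 1) *\<^sub>R w \<in> W \<longleftrightarrow> w \<in> W" for w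
  proof -
    define p where "p = y \<bullet> y"
    define q where "q = y \<bullet> w"
    have "(c + (- 1) *\<^sub>R w) \<bullet> (c + (- 1) *\<^sub>R w) - (y \<bullet> (c + (- 1) *\<^sub>R w))\<^sup>2 + 2 * (y \<bullet> (c + (- 1) *\<^sub>R w))
      = w \<bullet> w + 4 * \<kappa> * q + 4 * \<kappa>\<^sup>2 * p - (2 * \<kappa> * p + q)\<^sup>2 - 4 * \<kappa> * p - 2 * q"
      by (simp add: c_def p_def q_def algebra_simps inner_commute power2_eq_square)
    also have "\<dots> = w \<bullet> w - q\<^sup>2 + 2 * q"
      using \<kappa> unfolding p_def[symmetric] by algebra
    finally show ?thesis
      by (simp only: mem_Collect_eq mem_polar_gauge_cball[OF y] q_def)
  qed
  have half: "I / m = X" if "2 * I = m * Z" "Z = 2 * X" "0 < m" for I m X Z :: real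
    using that by simp
  have "(centroid (polar_wrt y (cball 0 1)) - y) \<bullet> u = (- \<kappa> *\<^sub>R y) \<bullet> u" for u
  proof -
    let ?I = "LINT w:W|lborel. u \<bullet> w"
    have ind: "indicator W (c + (- 1) *\<^sub>R w) = (indicator W w :: real)" for w
      using sym[of w] by (simp add: indicator_def)
    have [measurable]: "W \<in> sets borel" using compact_W by (rule borel_compact)
    have "?I = (LINT w|lborel. indicator W w * (u \<bullet> c) - indicator W w * (u \<bullet> w))"
      unfolding set_lebesgue_integral_def
      by (subst integral_lborel_affine[where c="-1" and t=c])
        (auto simp only: ind inner_add_right inner_scaleR_right real_scaleR_def ring_distribs
          intro!: Bochner_Integration.integral_cong, auto)
    also have "\<dots> = measure lborel W * (u \<bullet> c) - ?I"
    proof -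
      have "integrable lborel (\<lambda>w. indicator W w *\<^sub>R (u \<bullet> w))"
        "integrable lborel (\<lambda>w. indicator W w *\<^sub>R (u \<bullet> c))"
        by (intro borel_integrable_compact compact_W continuous_intros)+
      then show ?thesis
        by (subst Bochner_Integration.integral_diff) (auto simp: set_lebesgue_integral_def)
    qed
    finally have "2 * ?I = measure lborel W * (u \<bullet> c)" by linarith
    moreover have "u \<bullet> c = 2 * ((- \<kappa> *\<^sub>R y) \<bullet> u)" by (simp add: c_def inner_commute)
    ultimately have "?I / measure lborel W = (- \<kappa> *\<^sub>R y) \<bullet> u"
      using half[of ?I "measure lborel W" "u \<bullet> c"] measure_W(1) by blast
    then show ?thesis
      unfolding polar_wrt_eq[OF K ne] centroid_translate_inner[OF compact_W measure_W(1)] .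
  qed
  then show ?thesis unfolding \<kappa>_def by (metis vector_eq_rdot)
qed

lemma centroid_polar_eq_iff:
  fixes K :: "(real ^ 'n) set"
  assumes K: "compact K" and y: "y \<in> interior K" "norm y < 1"
  shows "centroid (polar_wrt y K) = centroid (polar_wrt y (cball 0 1)) \<longleftrightarrow>
    (\<forall>u. polar_moment K u 1 y / polar_moment K u 0 y + (real CARD('n) + 1) * (y \<bullet> u) / (1 - (norm y)\<^sup>2) = 0)"
proof -
  have "polar_moment K u 1 y / polar_moment K u 0 y + (real CARD('n) + 1) * (y \<bullet> u) / (1 - (norm y)\<^sup>2)
    = (real CARD('n) + 1) * ((centroid (polar_wrt y K) - centroid (polar_wrt y (cball 0 1))) \<bullet> u)" for u
  proof -
    have "(centroid (polar_wrt y K) - centroid (polar_wrt y (cball 0 1))) \<bullet> u =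
      (centroid (polar_wrt y K) - y) \<bullet> u + y \<bullet> u / (1 - (norm y)\<^sup>2)"
      using arg_cong[OF centroid_polar_cball[OF y(2)], of "\<lambda>x. x \<bullet> u"]
      by (simp add: inner_diff_left)
    then show ?thesis
      using centroid_polar_eq_moments[OF K y(1), of u] by (simp add: distrib_left)
  qed
  moreover have "(real CARD('n) + 1) \<noteq> 0" using of_nat_0_le_iff[of "CARD('n)"] by linarith
  ultimately have "(\<forall>u. polar_moment K u 1 y / polar_moment K u 0 y + (real CARD('n) + 1) * (y \<bullet> u) / (1 - (norm y)\<^sup>2) = 0)
     \<longleftrightarrow> (\<forall>u. (centroid (polar_wrt y K) - centroid (polar_wrt y (cball 0 1))) \<bullet> u = 0)"
    by simp
  also have "\<dots> \<longleftrightarrow> centroid (polar_wrt y K) = centroid (polar_wrt y (cball 0 1))"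
    by (metis eq_iff_diff_eq_0 inner_eq_zero_iff inner_zero_left)
  finally show ?thesis by simp
qed

section \<open>Differentiation with respect to the centre of polarity\<close>

lemma exp_remainder_bounds:
  fixes x :: real
  shows "0 \<le> exp x - 1 - x" "exp x - 1 - x \<le> x\<^sup>2 * exp \<bar>x\<bar>"
proof -
  have key: "exp t - 1 \<le> t * exp t" for t :: real
  proof -
    have "(1 - t) * exp t \<le> exp (- t) * exp t"
      using exp_ge_add_one_self[of "- t"] by (intro mult_right_mono) auto
    also have "\<dots> = 1" by (simp flip: exp_add)
    finally show ?thesis by (simp add: algebra_simps)
  qed
  show "0 \<le> exp x - 1 - x" using exp_ge_add_one_self[of x] by linarith
  have "exp x - 1 - x \<le> x * (exp x - 1)" using key[of x] by (simp add: algebra_simps)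
  also have "\<dots> \<le> x\<^sup>2 * exp \<bar>x\<bar>"
  proof (cases "0 \<le> x")
    case True
    then have "x * (exp x - 1) \<le> x * (x * exp x)" using key[of x] by (intro mult_left_mono)
    then show ?thesis using True by (simp add: power2_eq_square mult.assoc)
  next
    case False
    have "(- x) * (1 - exp x) \<le> (- x) * (- x)"
      using False exp_ge_add_one_self[of x] by (intro mult_left_mono) linarith+
    also have "\<dots> \<le> x\<^sup>2 * exp \<bar>x\<bar>"
      by (simp add: power2_eq_square mult_le_cancel_left1 not_less)
    finally show ?thesis by (simp add: algebra_simps)
  qed
  finally show "exp x - 1 - x \<le> x\<^sup>2 * exp \<bar>x\<bar>" .
qed

text \<open>By the remainder bound for the exponential, the error of the linear approximation is at most
  \<open>h\<^sup>2\<close> times an integral that does not depend on \<open>h\<close>; integrability at the two ends of an interval around \<open>0\<close>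
  dominates everything in between.\<close>
lemma has_derivative_exp_moment:
  fixes s \<rho> :: "'b \<Rightarrow> real"
  assumes [measurable]: "s \<in> borel_measurable M" "\<rho> \<in> borel_measurable M"
    and \<rho>: "\<And>x. 0 \<le> \<rho> x" and \<delta>: "0 < \<delta>"
    and int: "\<And>t k. \<bar>t\<bar> \<le> \<delta> \<Longrightarrow> integrable M (\<lambda>x. s x ^ k * (\<rho> x * exp (- (t * s x))))"
  shows "((\<lambda>t. LINT x|M. s x ^ k * (\<rho> x * exp (- (t * s x))))
    has_real_derivative - (LINT x|M. s x ^ Suc k * \<rho> x)) (at 0)"
proof -
  define F where "F t = (LINT x|M. s x ^ k * (\<rho> x * exp (- (t * s x))))" for t
  define D where "D = - (LINT x|M. s x ^ Suc k * \<rho> x)"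
  define B where "B x = \<bar>s x ^ (k + 2) * (\<rho> x * exp (- (\<delta> * s x)))\<bar>
      + \<bar>s x ^ (k + 2) * (\<rho> x * exp (- ((- \<delta>) * s x)))\<bar>" for x
  have intB: "integrable M B"
    unfolding B_def
    using integrable_abs[OF int[of \<delta> "k + 2"]] integrable_abs[OF int[of "- \<delta>" "k + 2"]] \<delta>
    by (intro Bochner_Integration.integrable_add) simp_all
  have int0: "integrable M (\<lambda>x. s x ^ j * \<rho> x)" for j
    using int[of 0 j] \<delta> by simp
  have bound: "\<bar>F h - F 0 - h * D\<bar> \<le> h\<^sup>2 * integral\<^sup>L M B" if h: "\<bar>h\<bar> \<le> \<delta>" for h
  proof -
    define G where "G x = s x ^ k * (\<rho> x * exp (- (h * s x))) - s x ^ k * \<rho> x + h * (s x ^ Suc k * \<rho> x)" for x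
    note i = int[OF h, of k] int0[of k] integrable_mult_right[OF int0[of "Suc k"], of h]
    note i' = Bochner_Integration.integrable_diff[OF i(1,2)]
    have intG: "integrable M G"
      unfolding G_def[abs_def] by (rule Bochner_Integration.integrable_add[OF i' i(3)])
    have "F h - F 0 - h * D = (LINT x|M. G x)"
      unfolding G_def Bochner_Integration.integral_add[OF i' i(3)] Bochner_Integration.integral_diff[OF i(1,2)]
      by (simp add: F_def D_def del: power_Suc)
    also have "\<bar>\<dots>\<bar> \<le> (LINT x|M. \<bar>G x\<bar>)"
      by (rule integral_abs_bound)
    also have "\<dots> \<le> (LINT x|M. h\<^sup>2 * B x)"
    proof (rule integral_mono)
      show "integrable M (\<lambda>x. \<bar>G x\<bar>)" by (rule integrable_abs[OF intG])
      show "integrable M (\<lambda>x. h\<^sup>2 * B x)" using intB by simp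
      fix x
      define y where "y = - (h * s x)"
      have "exp \<bar>y\<bar> \<le> exp (\<delta> * \<bar>s x\<bar>)"
        using h by (simp add: y_def abs_mult mult_right_mono)
      also have "\<dots> \<le> exp (- (\<delta> * s x)) + exp (- ((- \<delta>) * s x))"
        by (cases "0 \<le> s x") auto
      finally have e: "exp \<bar>y\<bar> \<le> exp (- (\<delta> * s x)) + exp (- ((- \<delta>) * s x))" .
      have "G x = (s x ^ k * \<rho> x) * (exp y - 1 - y)" by (simp add: G_def y_def algebra_simps)
      then have "\<bar>G x\<bar> = (\<bar>s x ^ k\<bar> * \<rho> x) * (exp y - 1 - y)"
        using \<rho>[of x] exp_remainder_bounds(1)[of y] by (simp add: abs_mult)
      also have "\<dots> \<le> (\<bar>s x ^ k\<bar> * \<rho> x) * (y\<^sup>2 * (exp (- (\<delta> * s x)) + exp (- ((- \<delta>) * s x))))"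
        using \<rho>[of x] e
        by (intro mult_left_mono order_trans[OF exp_remainder_bounds(2)]) auto
      also have "\<dots> = h\<^sup>2 * B x"
      proof -
        have "\<bar>s x ^ (k + 2)\<bar> = \<bar>s x ^ k\<bar> * (s x)\<^sup>2"
          by (simp add: power_add abs_mult power2_eq_square)
        then show ?thesis
          using \<rho>[of x] by (simp only: B_def y_def abs_mult[of "s x ^ (k + 2)"])
            (simp add: abs_mult power_mult_distrib algebra_simps)
      qed
      finally show "\<bar>G x\<bar> \<le> h\<^sup>2 * B x" .
    qed
    finally show ?thesis by simp
  qed
  have "((\<lambda>h. (F h - F 0) / h - D) \<longlongrightarrow> 0) (at 0)"
  proof (rule Lim_null_comparison)
    show "\<forall>\<^sub>F h in at 0. norm ((F h - F 0) / h - D) \<le> \<bar>h\<bar> * integral\<^sup>L M B"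
      unfolding eventually_at
    proof (intro exI[of _ \<delta>] conjI \<delta> ballI impI)
      fix h :: real assume "h \<noteq> 0 \<and> dist h 0 < \<delta>"
      then have h: "h \<noteq> 0" "\<bar>h\<bar> \<le> \<delta>" by auto
      have "norm ((F h - F 0) / h - D) = \<bar>F h - F 0 - h * D\<bar> / \<bar>h\<bar>"
        using h(1) by (simp add: diff_divide_distrib flip: abs_divide)
      also have "\<dots> \<le> h\<^sup>2 * integral\<^sup>L M B / \<bar>h\<bar>"
        using bound[OF h(2)] by (intro divide_right_mono) auto
      also have "\<dots> = \<bar>h\<bar> * integral\<^sup>L M B"
        using h(1) by (simp add: field_simps power2_eq_square abs_mult_self_eq)
      finally show "norm ((F h - F 0) / h - D) \<le> \<bar>h\<bar> * integral\<^sup>L M B" .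
    qed
    show "((\<lambda>h. \<bar>h\<bar> * integral\<^sup>L M B) \<longlongrightarrow> 0) (at 0)"
      by (auto intro!: tendsto_eq_intros)
  qed
  then have "((\<lambda>h. (F h - F 0) / h) \<longlongrightarrow> D) (at 0)"
    by (simp add: LIM_zero_iff)
  then have "(F has_real_derivative D) (at 0)"
    by (simp add: has_field_derivative_iff)
  then show ?thesis by (simp add: F_def[abs_def] D_def)
qed

context interior_point
begin

lemma has_derivative_moment_0:
  "((\<lambda>t. polar_moment K u k (y + t *\<^sub>R u)) has_real_derivative - polar_moment K u (Suc k) y) (at 0)"
proof -
  obtain r where r: "0 < r" "cball y r \<subseteq> interior K"
    using mem by (meson open_contains_cball open_interior)
  define \<delta> where "\<delta> = r / (norm u + 1)"
  have \<delta>: "0 < \<delta>" using r by (simp add: \<delta>_def add_nonneg_pos)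
  have eq: "(u \<bullet> w) ^ j * exp (- polar_gauge K (y + t *\<^sub>R u) w)
      = (u \<bullet> w) ^ j * (exp (- polar_gauge K y w) * exp (- (t * (u \<bullet> w))))" for j t w
    by (simp add: polar_gauge_translate[OF K ne] inner_commute flip: exp_add)
  have "integrable lborel (\<lambda>w. (u \<bullet> w) ^ j * (exp (- polar_gauge K y w) * exp (- (t * (u \<bullet> w)))))"
    if t: "\<bar>t\<bar> \<le> \<delta>" for t j
  proof -
    have "\<bar>t\<bar> * norm u \<le> \<delta> * (norm u + 1)" using t by (intro mult_mono) auto
    then have "\<bar>t\<bar> * norm u \<le> r" by (simp add: \<delta>_def add_nonneg_eq_0_iff)
    then have "y + t *\<^sub>R u \<in> interior K" using r by (auto simp: dist_norm)
    with K interpret t: interior_point K "y + t *\<^sub>R u" by (rule interior_point.intro)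
    show ?thesis using t.moment_integrable[of u j] unfolding eq .
  qed
  from has_derivative_exp_moment[OF _ _ _ \<delta> this, of k]
  show ?thesis unfolding polar_moment_def eq by simp
qed

end

lemma has_derivative_moment:
  assumes "compact K" "y + t *\<^sub>R u \<in> interior K"
  shows "((\<lambda>t. polar_moment K u k (y + t *\<^sub>R u)) has_real_derivative
    - polar_moment K u (Suc k) (y + t *\<^sub>R u)) (at t)"
proof -
  interpret interior_point K "y + t *\<^sub>R u" by unfold_locales fact+
  have "((\<lambda>s. polar_moment K u k (y + (s + t) *\<^sub>R u)) has_real_derivative
    - polar_moment K u (Suc k) (y + t *\<^sub>R u)) (at 0)"
    using has_derivative_moment_0[of u k] by (simp add: algebra_simps)
  then show ?thesis
    using DERIV_shift[of "\<lambda>t. polar_moment K u k (y + t *\<^sub>R u)" _ 0 t] by simp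
qed

text \<open>By \<open>centroid_polar_eq_moments\<close> and \<open>centroid_polar_cball\<close> this is \<open>d + 1\<close> times the component in direction \<open>u\<close> of the difference between the
  centroids of the polars of \<open>K\<close> and of the unit ball.\<close>
definition centroid_gap :: "'a::euclidean_space set \<Rightarrow> 'a \<Rightarrow> 'a \<Rightarrow> real" where
  "centroid_gap K u y = polar_moment K u 1 y / polar_moment K u 0 y
     + (real DIM('a) + 1) * (y \<bullet> u) / (1 - (norm y)\<^sup>2)"

lemma has_derivative_centroid_gap:
  fixes K :: "'a::euclidean_space set" and y u :: 'a
  assumes K: "compact K" and yt: "y + t *\<^sub>R u \<in> interior K" "norm (y + t *\<^sub>R u) < 1"
  defines "x \<equiv> y + t *\<^sub>R u"
  shows "((\<lambda>t. centroid_gap K u (y + t *\<^sub>R u)) has_real_derivative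
    - polar_moment K u 2 x / polar_moment K u 0 x + (polar_moment K u 1 x / polar_moment K u 0 x)\<^sup>2
    + (real DIM('a) + 1) * (u \<bullet> u / (1 - (norm x)\<^sup>2) + 2 * (x \<bullet> u / (1 - (norm x)\<^sup>2))\<^sup>2)) (at t)"
proof -
  interpret interior_point K "x" unfolding x_def by unfold_locales fact+
  have D0: "((\<lambda>t. polar_moment K u 0 (y + t *\<^sub>R u)) has_real_derivative - polar_moment K u 1 x) (at t)"
    and D1: "((\<lambda>t. polar_moment K u 1 (y + t *\<^sub>R u)) has_real_derivative - polar_moment K u 2 x) (at t)"
    using has_derivative_moment[OF K yt(1)] by (auto simp: x_def numeral_2_eq_2)
  have "(norm x)\<^sup>2 < 1" using yt(2) by (simp add: abs_square_less_1 x_def)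
  then have E: "1 - x \<bullet> x > 0" by (simp add: power2_norm_eq_inner)
  have D2: "((\<lambda>t. (y + t *\<^sub>R u) \<bullet> u) has_real_derivative u \<bullet> u) (at t)"
    by (auto simp: inner_add_left intro!: derivative_eq_intros)
  have D3: "((\<lambda>t. 1 - (y + t *\<^sub>R u) \<bullet> (y + t *\<^sub>R u)) has_real_derivative - 2 * (x \<bullet> u)) (at t)"
    by (auto simp: x_def inner_add_left inner_add_right inner_commute algebra_simps intro!: derivative_eq_intros)
  note pos = moment_0_pos[of u]
  define N where "N k = polar_moment K u k x" for k
  have "((\<lambda>t. polar_moment K u 1 (y + t *\<^sub>R u) / polar_moment K u 0 (y + t *\<^sub>R u)
     + (real DIM('a) + 1) * ((y + t *\<^sub>R u) \<bullet> u / (1 - (y + t *\<^sub>R u) \<bullet> (y + t *\<^sub>R u)))) has_real_derivative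
    (- N 2 * N 0 - N 1 * - N 1) / (N 0 * N 0)
    + (real DIM('a) + 1) * (((u \<bullet> u) * (1 - x \<bullet> x) - (x \<bullet> u) * (- 2 * (x \<bullet> u))) / ((1 - x \<bullet> x) * (1 - x \<bullet> x)))) (at t)"
    unfolding N_def
    by (intro DERIV_add DERIV_cmult DERIV_divide[OF D1 D0, folded x_def] DERIV_divide[OF D2 D3, folded x_def])
      (use pos E in auto)
  also have "(- N 2 * N 0 - N 1 * - N 1) / (N 0 * N 0) = - N 2 / N 0 + (N 1 / N 0)\<^sup>2"
    using pos unfolding N_def[symmetric] by (simp add: field_simps power2_eq_square)
  also have "((u \<bullet> u) * (1 - x \<bullet> x) - (x \<bullet> u) * (- 2 * (x \<bullet> u))) / ((1 - x \<bullet> x) * (1 - x \<bullet> x))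
      = u \<bullet> u / (1 - x \<bullet> x) + 2 * (x \<bullet> u / (1 - x \<bullet> x))\<^sup>2"
    using E by (simp add: add_divide_distrib power2_eq_square)
  finally show ?thesis
    by (simp add: centroid_gap_def N_def power2_norm_eq_inner)
qed

section \<open>Width and variance of a polar body\<close>

context interior_point
begin

text \<open>The variance bound for \<open>W\<close>, taken about its centroid and rewritten in terms of the exponential
  moments; the factorials produce the quotient \<open>(d + 2) / (d + 1)\<close>.\<close>
lemma variance_W_ge:
  assumes "p \<in> W" "q \<in> W" "\<And>w. w \<in> W \<Longrightarrow> u \<bullet> w \<le> u \<bullet> p" "\<And>w. w \<in> W \<Longrightarrow> u \<bullet> q \<le> u \<bullet> w"
  shows "(u \<bullet> p - u \<bullet> q)\<^sup>2 / 2 + (real DIM('a) + 2) / (real DIM('a) + 1) * (polar_moment K u 1 y / polar_moment K u 0 y)\<^sup>2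
    \<le> polar_moment K u 2 y / polar_moment K u 0 y"
proof -
  define d where "d = real DIM('a)"
  have d: "d \<ge> 1" unfolding d_def by (simp add: Suc_leI)
  define m where "m = measure lborel W"
  have m: "0 < m" unfolding m_def by (rule measure_W)
  define A1 where "A1 = (LINT w:W|lborel. u \<bullet> w) / m"
  define A2 where "A2 = (LINT w:W|lborel. (u \<bullet> w)\<^sup>2) / m"
  have N1: "polar_moment K u 1 y / polar_moment K u 0 y = (d + 1) * A1"
    unfolding moment_0 using moment_eq[of u 1] by (simp add: A1_def m_def d_def add.commute)
  have N2: "polar_moment K u 2 y / polar_moment K u 0 y = (d + 1) * (d + 2) * A2"
    unfolding moment_0 using moment_eq[of u 2] by (simp add: A2_def m_def d_def add.commute mult_ac)
  have "(u \<bullet> p - u \<bullet> q)\<^sup>2 / (2 * (d + 1) * (d + 2)) * m \<le> (LINT w:W|lborel. (u \<bullet> w - A1)\<^sup>2)"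
    unfolding d_def m_def using compact_W convex_W assms
    by (intro second_moment_ge_width) (auto intro: borel_compact compact_imp_bounded)
  also have "\<dots> = (LINT w:W|lborel. (u \<bullet> w)\<^sup>2 - (2 * A1) * (u \<bullet> w) + A1\<^sup>2)"
    by (intro set_lebesgue_integral_cong) (auto simp: power2_diff intro: borel_compact[OF compact_W])
  also have "\<dots> = (LINT w:W|lborel. (u \<bullet> w)\<^sup>2) - (2 * A1) * (LINT w:W|lborel. u \<bullet> w) + A1\<^sup>2 * m"
  proof -
    have i: "set_integrable lborel W (\<lambda>w. (u \<bullet> w)\<^sup>2)" "set_integrable lborel W (\<lambda>w. (2 * A1) * (u \<bullet> w))"
      "set_integrable lborel W (\<lambda>w. A1\<^sup>2)" "set_integrable lborel W (\<lambda>w. (u \<bullet> w)\<^sup>2 - (2 * A1) * (u \<bullet> w))"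
      by (intro set_integrable_W continuous_intros)+
    have c: "(LINT w:W|lborel. A1\<^sup>2) = A1\<^sup>2 * m"
      by (simp add: set_lebesgue_integral_def m_def)
    show ?thesis
      unfolding set_integral_add(2)[OF i(4,3)] set_integral_diff(2)[OF i(1,2)] c by simp
  qed
  also have "\<dots> = (A2 - A1\<^sup>2) * m"
  proof -
    have "(LINT w:W|lborel. (u \<bullet> w)\<^sup>2) = A2 * m" "(LINT w:W|lborel. u \<bullet> w) = A1 * m"
      using m by (auto simp: A1_def A2_def)
    then show ?thesis by (simp add: power2_eq_square algebra_simps)
  qed
  finally have "(u \<bullet> p - u \<bullet> q)\<^sup>2 / (2 * (d + 1) * (d + 2)) \<le> A2 - A1\<^sup>2"
    using m by (rule mult_right_le_imp_le)
  then have e1: "(d + 1) * (d + 2) * ((u \<bullet> p - u \<bullet> q)\<^sup>2 / (2 * (d + 1) * (d + 2))) \<le> (d + 1) * (d + 2) * (A2 - A1\<^sup>2)"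
    using d by (intro mult_left_mono) auto
  have e2: "(d + 1) * (d + 2) * ((u \<bullet> p - u \<bullet> q)\<^sup>2 / (2 * (d + 1) * (d + 2))) = (u \<bullet> p - u \<bullet> q)\<^sup>2 / 2"
  proof -
    define P where "P = (d + 1) * (d + 2)"
    have "P \<noteq> 0" "2 * (d + 1) * (d + 2) = 2 * P" using d by (auto simp: P_def)
    then show ?thesis unfolding P_def[symmetric] by simp
  qed
  have e3: "(d + 2) / (d + 1) * ((d + 1) * A1)\<^sup>2 = (d + 1) * (d + 2) * A1\<^sup>2"
    using d by (simp add: power2_eq_square)
  show ?thesis
    unfolding N1 N2 d_def[symmetric] using e1[unfolded e2 right_diff_distrib] e3 by linarith
qed

text \<open>Bipolar duality along a line: a point of the form \<open>y - u / a\<close> outside of \<open>K\<close> would be separated from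
  \<open>K\<close> by a hyperplane, and the normalised normal vector would be a point of \<open>W\<close> on which \<open>u\<close> exceeds
  \<open>a\<close>.\<close>
lemma chord_point_in_K:
  assumes "convex K" "0 < a" "\<And>w. w \<in> W \<Longrightarrow> u \<bullet> w \<le> a"
  shows "y - (1 / a) *\<^sub>R u \<in> K"
proof (rule ccontr)
  assume "y - (1 / a) *\<^sub>R u \<notin> K"
  then obtain e b where eb: "e \<bullet> (y - (1 / a) *\<^sub>R u) < b" "\<And>x. x \<in> K \<Longrightarrow> b < e \<bullet> x"
    using separating_hyperplane_closed_point[OF assms(1) compact_imp_closed[OF K]] by metis
  have pos: "0 < e \<bullet> y - b" using eb(2)[of y] mem interior_subset by auto
  have "((1 / (e \<bullet> y - b)) *\<^sub>R e) \<bullet> (y - z) \<le> 1" if "z \<in> K" for z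
  proof -
    have "e \<bullet> (y - z) \<le> e \<bullet> y - b" using eb(2)[OF that] by (simp add: inner_diff_right)
    then show ?thesis using pos by simp
  qed
  then have "(1 / (e \<bullet> y - b)) *\<^sub>R e \<in> W"
    by (simp add: polar_gauge_le_iff[OF K ne])
  from assms(3)[OF this] have "u \<bullet> e \<le> a * (e \<bullet> y - b)"
    using pos by (simp add: field_simps)
  then have "(u \<bullet> e) / a \<le> e \<bullet> y - b" using assms(2) by (simp add: field_simps)
  then show False using eb(1) by (simp add: inner_diff_right inner_commute)
qed

lemma extreme_points_W:
  assumes "u \<noteq> 0"
  obtains p q where "p \<in> W" "q \<in> W" "\<And>w. w \<in> W \<Longrightarrow> u \<bullet> w \<le> u \<bullet> p" "\<And>w. w \<in> W \<Longrightarrow> u \<bullet> q \<le> u \<bullet> w"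
    "0 < u \<bullet> p" "u \<bullet> q < 0"
proof -
  obtain R where R: "0 < R" "\<And>z. z \<in> K \<Longrightarrow> norm (y - z) \<le> R"
    using compact_imp_bounded[OF compact_translation[OF compact_negations[OF K], of y]]
    unfolding bounded_pos by (auto simp: image_image)
  have sub: "cball 0 (1 / R) \<subseteq> W"
    using R by (intro ball_subset_W) (auto simp: dist_norm)
  have "0 \<in> W" using R(1) by (intro subsetD[OF sub]) simp
  then have "W \<noteq> {}" by blast
  have c: "continuous_on W (\<lambda>w. u \<bullet> w)" by (intro continuous_intros)
  obtain p where p: "p \<in> W" "\<And>w. w \<in> W \<Longrightarrow> u \<bullet> w \<le> u \<bullet> p"
    using continuous_attains_sup[OF compact_W \<open>W \<noteq> {}\<close> c] by blast
  obtain q where q: "q \<in> W" "\<And>w. w \<in> W \<Longrightarrow> u \<bullet> q \<le> u \<bullet> w"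
    using continuous_attains_inf[OF compact_W \<open>W \<noteq> {}\<close> c] by blast
  define e where "e = (1 / (R * norm u)) *\<^sub>R u"
  have "norm e = 1 / R" using assms R(1) by (simp add: e_def)
  then have "e \<in> cball 0 (1 / R)" "- e \<in> cball 0 (1 / R)" by auto
  then have "e \<in> W" "- e \<in> W" using sub by blast+
  moreover have "0 < u \<bullet> e" using assms R(1) by (simp add: e_def)
  ultimately have "0 < u \<bullet> p" "u \<bullet> q < 0"
    using p(2)[of e] q(2)[of "- e"] by auto
  with p q show ?thesis by (intro that[of p q])
qed

end

section \<open>Hyperbolic distance and the width of the polar\<close>

text \<open>On a line through \<open>y\<close>, with \<open>y\<close> at position \<open>\<sigma>\<close>, the unit ball cuts out \<open>[- l, l]\<close>, and the
  points at \<open>\<sigma> + 1 / b\<close> and \<open>\<sigma> - 1 / a\<close> lie in \<open>K\<close>.  The projective map \<open>x \<mapsto> 1 / (x - \<sigma>)\<close>, followed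
  by the affine map that takes the images of the chord's ends to \<open>1\<close> and \<open>-1\<close>, preserves the cross-ratio and
  moves the two points to \<open>Q > 1\<close> and \<open>- P < -1\<close>.  There the cross-ratio is
  \<open>(P + 1) (Q + 1) / ((P - 1) (Q - 1))\<close>; for a given sum \<open>P + Q\<close> it is least when \<open>P = Q\<close>, and at
  \<open>P = Q = 1 / r\<close> it equals the bound.\<close>
lemma cross_ratio_less_imp_width:
  fixes a b r \<sigma> l E :: real
  assumes pos: "0 < E" "0 < l" "0 < a" "0 < b" "0 < r" "r < 1" and l: "l\<^sup>2 = E + \<sigma>\<^sup>2"
    and s: "\<sigma> + 1 / b < l" "- l < \<sigma> - 1 / a"
    and less: "(l + (\<sigma> + 1 / b)) * (l - (\<sigma> - 1 / a)) / ((l - (\<sigma> + 1 / b)) * (l + (\<sigma> - 1 / a)))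
      < ((1 + r) / (1 - r))\<^sup>2"
  shows "2 * l < r * E * (a + b)"
proof -
  have E: "E = (l - \<sigma>) * (l + \<sigma>)" using l by (simp add: power2_eq_square algebra_simps)
  have "\<sigma>\<^sup>2 < l\<^sup>2" using l pos by simp
  then have "\<bar>\<sigma>\<bar> < l" using pos abs_le_square_iff[of l \<sigma>] by (simp add: not_le)
  then have \<sigma>: "0 < l - \<sigma>" "0 < l + \<sigma>" by auto
  define P where "P = (a * E + \<sigma>) / l"
  define Q where "Q = (b * E - \<sigma>) / l"
  have bl: "0 < b * (l - \<sigma>) - 1" and al: "0 < a * (l + \<sigma>) - 1"
    using s pos by (auto simp: field_simps)
  have P1: "l * (P - 1) = (l - \<sigma>) * (a * (l + \<sigma>) - 1)" "l * (P + 1) = (l + \<sigma>) * (a * (l - \<sigma>) + 1)"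
    and Q1: "l * (Q - 1) = (l + \<sigma>) * (b * (l - \<sigma>) - 1)" "l * (Q + 1) = (l - \<sigma>) * (b * (l + \<sigma>) + 1)"
  proof -
    have lPQ: "l * P = a * E + \<sigma>" "l * Q = b * E - \<sigma>"
      using pos by (simp_all add: P_def Q_def)
    show "l * (P - 1) = (l - \<sigma>) * (a * (l + \<sigma>) - 1)" "l * (P + 1) = (l + \<sigma>) * (a * (l - \<sigma>) + 1)"
      "l * (Q - 1) = (l + \<sigma>) * (b * (l - \<sigma>) - 1)" "l * (Q + 1) = (l - \<sigma>) * (b * (l + \<sigma>) + 1)"
      unfolding right_diff_distrib[of l] distrib_left[of l] lPQ E by (simp_all add: algebra_simps)
  qed
  have PQ: "1 < P" "1 < Q"
  proof -
    have "0 < l * (P - 1)" "0 < l * (Q - 1)"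
      unfolding P1(1) Q1(1) using \<sigma> al bl by (auto intro!: mult_pos_pos)
    then show "1 < P" "1 < Q" using pos by (auto simp: zero_less_mult_iff)
  qed
  have X: "(l + (\<sigma> + 1 / b)) * (l - (\<sigma> - 1 / a)) / ((l - (\<sigma> + 1 / b)) * (l + (\<sigma> - 1 / a)))
     = (P + 1) * (Q + 1) / ((P - 1) * (Q - 1))"
  proof -
    have "(P + 1) * (Q + 1) / ((P - 1) * (Q - 1)) = ((l * (P + 1)) * (l * (Q + 1))) / ((l * (P - 1)) * (l * (Q - 1)))"
      using pos by simp
    also have "\<dots> = (((l - \<sigma>) * (l + \<sigma>)) * ((b * (l + \<sigma>) + 1) * (a * (l - \<sigma>) + 1)))
        / (((l - \<sigma>) * (l + \<sigma>)) * ((b * (l - \<sigma>) - 1) * (a * (l + \<sigma>) - 1)))"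
      unfolding P1 Q1 by (simp add: mult_ac)
    also have "\<dots> = ((b * (l + \<sigma>) + 1) * (a * (l - \<sigma>) + 1)) / ((b * (l - \<sigma>) - 1) * (a * (l + \<sigma>) - 1))"
      using \<sigma> by (intro mult_divide_mult_cancel_left) auto
    also have "\<dots> = ((b * (l + (\<sigma> + 1 / b))) * (a * (l - (\<sigma> - 1 / a)))) / ((b * (l - (\<sigma> + 1 / b))) * (a * (l + (\<sigma> - 1 / a))))"
      using pos by (simp add: algebra_simps)
    also have "\<dots> = (l + (\<sigma> + 1 / b)) * (l - (\<sigma> - 1 / a)) / ((l - (\<sigma> + 1 / b)) * (l + (\<sigma> - 1 / a)))"
      using pos by simp
    finally show ?thesis by simp
  qed
  have "2 < r * (P + Q)"
  proof (rule ccontr)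
    assume "\<not> 2 < r * (P + Q)"
    then have le: "r * (P + Q) \<le> 2" by simp
    define S where "S = P + Q"
    have "0 \<le> (1 - r * S / 2) * (S - 2 * r)"
      using le PQ pos unfolding S_def by (intro mult_nonneg_nonneg) auto
    also have "\<dots> = (1 + r\<^sup>2) * S - 2 * r * (S\<^sup>2 / 4 + 1)"
      by (simp add: power2_eq_square field_simps)
    also have "\<dots> \<le> (1 + r\<^sup>2) * S - 2 * r * (P * Q + 1)"
    proof -
      have "P * Q \<le> S\<^sup>2 / 4"
        using zero_le_power2[of "P - Q"] by (simp add: S_def power2_eq_square algebra_simps)
      then show ?thesis using pos by simp
    qed
    finally have *: "(1 + r)\<^sup>2 * ((P - 1) * (Q - 1)) \<le> (1 - r)\<^sup>2 * ((P + 1) * (Q + 1))"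
      by (simp add: S_def power2_eq_square algebra_simps)
    then have "((1 + r) / (1 - r))\<^sup>2 \<le> (P + 1) * (Q + 1) / ((P - 1) * (Q - 1))"
    proof -
      have pp: "0 < (P - 1) * (Q - 1)" and rr: "0 < (1 - r)\<^sup>2" using PQ pos by auto
      show ?thesis
        unfolding power_divide pos_le_divide_eq[OF pp] times_divide_eq_left pos_divide_le_eq[OF rr]
        using * by (simp only: mult.commute)
    qed
    with less X show False by simp
  qed
  also have "P + Q = (a + b) * E / l"
    unfolding P_def Q_def by (simp add: algebra_simps flip: add_divide_distrib)
  finally show ?thesis using pos by (simp add: field_simps)
qed

text \<open>Here \<open>m\<close> is the midpoint of the chord and \<open>l\<close> is half its length.  Exchanging the two ends of the
  chord inverts the cross-ratio, so the value is well defined.\<close>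
lemma hyperbolic_dist_chord:
  fixes m u :: "real ^ 'n"
  assumes u: "norm u = 1" and mu: "m \<bullet> u = 0" and l: "0 < l" "l\<^sup>2 = 1 - (norm m)\<^sup>2"
    and s: "\<bar>s\<bar> < l" and t: "\<bar>t\<bar> < l" and "s \<noteq> t"
  shows "hyperbolic_dist (m + s *\<^sub>R u) (m + t *\<^sub>R u)
    = ereal (1 / 2 * \<bar>ln ((l + s) * (l - t) / ((l - s) * (l + t)))\<bar>)"
proof -
  let ?p = "m + s *\<^sub>R u" and ?q = "m + t *\<^sub>R u"
  let ?a = "m + (- l) *\<^sub>R u" and ?b = "m + l *\<^sub>R u"
  have "u \<noteq> 0" using u by auto
  have inj: "m + x *\<^sub>R u = m + x' *\<^sub>R u \<longleftrightarrow> x = x'" for x x'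
    using \<open>u \<noteq> 0\<close> by simp
  have nrm: "(norm (m + x *\<^sub>R u))\<^sup>2 = (norm m)\<^sup>2 + x\<^sup>2" for x
    using u mu unfolding power2_norm_eq_inner norm_eq_1
    by (simp add: inner_add_left inner_add_right inner_commute power2_eq_square)
  have norm_less: "norm (m + x *\<^sub>R u) < 1" if "\<bar>x\<bar> < l" for x
  proof -
    have "x\<^sup>2 < l\<^sup>2" using that abs_le_square_iff[of l x] l(1) by (simp flip: not_le)
    then have "(norm (m + x *\<^sub>R u))\<^sup>2 < 1" unfolding nrm using l by simp
    then show ?thesis by (simp add: abs_square_less_1)
  qed
  have dst: "dist (m + x *\<^sub>R u) (m + x' *\<^sub>R u) = \<bar>x - x'\<bar>" for x x'
    using u by (simp add: dist_norm flip: scaleR_left_diff_distrib)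
  have hull: "affine hull {?p, ?q} = range (\<lambda>x. m + x *\<^sub>R u)"
  proof -
    have param: "?p + x *\<^sub>R (?q - ?p) = m + (s + x * (t - s)) *\<^sub>R u" for x
      by (simp add: algebra_simps)
    have "surj (\<lambda>x. s + x * (t - s))"
      by (rule surjI[of _ "\<lambda>x. (x - s) / (t - s)"]) (use \<open>s \<noteq> t\<close> in simp)
    then have "range (\<lambda>x. m + (s + x * (t - s)) *\<^sub>R u) = range (\<lambda>x. m + x *\<^sub>R u)"
      using image_image[of "\<lambda>x. m + x *\<^sub>R u" "\<lambda>x. s + x * (t - s)" UNIV] by simp
    then show ?thesis unfolding affine_hull_2_alt param .
  qed
  have "norm (m + x *\<^sub>R u) = 1 \<longleftrightarrow> x = - l \<or> x = l" for x
  proof -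
    have "norm (m + x *\<^sub>R u) = 1 \<longleftrightarrow> (norm (m + x *\<^sub>R u))\<^sup>2 = 1"
      using norm_ge_zero[of "m + x *\<^sub>R u"] by (smt (verit) power2_eq_1_iff)
    also have "\<dots> \<longleftrightarrow> x\<^sup>2 = l\<^sup>2" unfolding nrm using l by auto
    finally show ?thesis by (auto simp: power2_eq_iff)
  qed
  then have "{x. norm (m + x *\<^sub>R u) = 1} = {- l, l}" by auto
  moreover have "range (\<lambda>x. m + x *\<^sub>R u) \<inter> sphere 0 1 = (\<lambda>x. m + x *\<^sub>R u) ` {x. norm (m + x *\<^sub>R u) = 1}"
    by auto
  ultimately have ends: "affine hull {?p, ?q} \<inter> sphere 0 1 = {?a, ?b}"
    unfolding hull by (simp only: image_insert image_empty)
  have cr: "abs_cross_ratio ?p ?q ?a ?b = (l + s) * (l - t) / ((l - s) * (l + t))"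
    "abs_cross_ratio ?p ?q ?b ?a = inverse ((l + s) * (l - t) / ((l - s) * (l + t)))"
  proof -
    have abs: "\<bar>s - (- l)\<bar> = l + s" "\<bar>t - l\<bar> = l - t" "\<bar>s - l\<bar> = l - s" "\<bar>t - (- l)\<bar> = l + t"
      using s t by linarith+
    show "abs_cross_ratio ?p ?q ?a ?b = (l + s) * (l - t) / ((l - s) * (l + t))"
      "abs_cross_ratio ?p ?q ?b ?a = inverse ((l + s) * (l - t) / ((l - s) * (l + t)))"
      unfolding abs_cross_ratio_def dst abs by simp_all
  qed
  have "0 < (l + s) * (l - t) / ((l - s) * (l + t))"
    using s t by (auto intro!: divide_pos_pos mult_pos_pos)
  then have "\<bar>ln (abs_cross_ratio ?p ?q ?b ?a)\<bar> = \<bar>ln (abs_cross_ratio ?p ?q ?a ?b)\<bar>"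
    unfolding cr by (subst ln_inverse) (simp_all only: abs_minus_cancel)
  then have "(THE r. \<exists>a b. a \<noteq> b \<and> affine hull {?p, ?q} \<inter> sphere 0 1 = {a, b} \<and>
                           r = 1 / 2 * \<bar>ln (abs_cross_ratio ?p ?q a b)\<bar>)
    = 1 / 2 * \<bar>ln (abs_cross_ratio ?p ?q ?a ?b)\<bar>"
  proof (intro the_equality, goal_cases)
    case 1
    have "?a \<noteq> ?b" unfolding inj using l by simp
    then show ?case using ends by blast
  next
    case (2 r)
    then obtain a b where "{?a, ?b} = {a, b}" "r = 1 / 2 * \<bar>ln (abs_cross_ratio ?p ?q a b)\<bar>"
      unfolding ends by blast
    with 2(1) show ?case by (auto simp: doubleton_eq_iff)
  qed
  moreover have "?p \<noteq> ?q" unfolding inj by fact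
  ultimately show ?thesis
    unfolding hyperbolic_dist_def cr using norm_less[OF s] norm_less[OF t] by simp
qed

text \<open>With \<open>r\<^sup>2 = 2 / (d + 1)\<close> this compares the widths in direction \<open>u\<close> of the two polars: \<open>a + b\<close> is that of the polar of
  \<open>K\<close> when the two points are the ends of its chord, and four times the bracket on the left is the
  squared width of the ellipsoid.\<close>
lemma hyperbolic_dist_less_imp_width:
  fixes y u :: "real ^ 'n"
  assumes u: "norm u = 1" and y: "norm y < 1" and ab: "0 < a" "0 < b" and r: "0 < r" "r < 1"
    and nrm: "norm (y + (1 / b) *\<^sub>R u) < 1" "norm (y - (1 / a) *\<^sub>R u) < 1"
    and less: "hyperbolic_dist (y + (1 / b) *\<^sub>R u) (y - (1 / a) *\<^sub>R u) < ereal (ln ((1 + r) / (1 - r)))"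
  shows "4 * ((y \<bullet> u / (1 - (norm y)\<^sup>2))\<^sup>2 + 1 / (1 - (norm y)\<^sup>2)) < r\<^sup>2 * (a + b)\<^sup>2"
proof -
  define \<sigma> where "\<sigma> = y \<bullet> u"
  define m where "m = y - \<sigma> *\<^sub>R u"
  define E where "E = 1 - (norm y)\<^sup>2"
  define l where "l = sqrt (E + \<sigma>\<^sup>2)"
  have E: "0 < E" using y by (simp add: E_def abs_square_less_1)
  have l: "0 < l" "l\<^sup>2 = E + \<sigma>\<^sup>2" using E by (auto simp: l_def add_pos_nonneg)
  have mu: "m \<bullet> u = 0" using u by (simp add: m_def \<sigma>_def inner_diff_left norm_eq_1)
  have ym: "y = m + \<sigma> *\<^sub>R u" by (simp add: m_def)
  have nm: "(norm (m + x *\<^sub>R u))\<^sup>2 = (norm m)\<^sup>2 + x\<^sup>2" for x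
    using u mu unfolding power2_norm_eq_inner norm_eq_1
    by (simp add: inner_add_left inner_add_right inner_commute power2_eq_square)
  have lm: "l\<^sup>2 = 1 - (norm m)\<^sup>2"
    using nm[of \<sigma>] unfolding l E_def ym by simp
  define s where "s = \<sigma> + 1 / b"
  define t where "t = \<sigma> - 1 / a"
  have p: "y + (1 / b) *\<^sub>R u = m + s *\<^sub>R u" and q: "y - (1 / a) *\<^sub>R u = m + t *\<^sub>R u"
    by (simp_all add: s_def t_def m_def algebra_simps)
  have less_l: "\<bar>x\<bar> < l" if "norm (m + x *\<^sub>R u) < 1" for x
  proof -
    have "(norm (m + x *\<^sub>R u))\<^sup>2 < 1" using that by (simp add: abs_square_less_1)
    then have "x\<^sup>2 < l\<^sup>2" unfolding nm lm by simp
    then show ?thesis using l(1) abs_le_square_iff[of l x] by (simp add: not_le)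
  qed
  have s: "\<bar>s\<bar> < l" and t: "\<bar>t\<bar> < l" using less_l nrm unfolding p q by auto
  have "t < \<sigma>" "\<sigma> < s" using ab by (auto simp: s_def t_def)
  then have st: "t < s" by simp
  define X where "X = (l + s) * (l - t) / ((l - s) * (l + t))"
  have "(l - s) * (l + t) \<le> (l + s) * (l - t)" using st l by (simp add: algebra_simps)
  then have X: "1 \<le> X" unfolding X_def using s t by (subst le_divide_eq_1_pos) (auto intro!: mult_pos_pos)
  have "1 / 2 * \<bar>ln X\<bar> < ln ((1 + r) / (1 - r))"
    using less unfolding p q hyperbolic_dist_chord[OF u mu l(1) lm s t less_imp_neq[OF st, symmetric]] X_def by simp
  then have "ln X < 2 * ln ((1 + r) / (1 - r))" using X by simp
  also have "\<dots> = ln (((1 + r) / (1 - r))\<^sup>2)" using r by (simp add: ln_realpow)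
  finally have "X < ((1 + r) / (1 - r))\<^sup>2" using X r by (subst (asm) ln_less_cancel_iff) auto
  then have "2 * l < r * E * (a + b)"
    unfolding X_def s_def t_def using s t unfolding s_def t_def
    by (intro cross_ratio_less_imp_width[OF E l(1) ab r l(2)]) auto
  then have "(2 * l)\<^sup>2 < (r * E * (a + b))\<^sup>2"
    using l(1) by (intro power_strict_mono) auto
  then have "4 * (E + \<sigma>\<^sup>2) < (r\<^sup>2 * (a + b)\<^sup>2) * E\<^sup>2"
    using l(2) by (simp add: power_mult_distrib mult_ac)
  then have "4 * (E + \<sigma>\<^sup>2) / E\<^sup>2 < r\<^sup>2 * (a + b)\<^sup>2"
    using E by (simp add: pos_divide_less_eq)
  moreover have "4 * (E + \<sigma>\<^sup>2) / E\<^sup>2 = 4 * ((\<sigma> / E)\<^sup>2 + 1 / E)"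
    using E by (simp add: field_simps power2_eq_square)
  ultimately show ?thesis by (simp add: \<sigma>_def E_def)
qed

text \<open>The Euclidean ball of radius \<open>\<rho>\<close> about the origin is the hyperbolic ball of radius
  \<open>ln ((1 + \<rho>) / (1 - \<rho>)) / 2\<close>.  In coordinates: on a chord of half-length \<open>l\<close> the points of the ball have
  parameters of modulus at most \<open>\<rho> * l\<close>.\<close>
lemma hyperbolic_dist_le_of_norm_le:
  fixes p q :: "real ^ 'n"
  assumes p: "norm p \<le> \<rho>" and q: "norm q \<le> \<rho>" and \<rho>: "\<rho> < 1"
  shows "hyperbolic_dist p q \<le> ereal (ln ((1 + \<rho>) / (1 - \<rho>)))"
proof (cases "p = q")
  case True
  have "0 \<le> \<rho>" using p norm_ge_zero[of p] by linarith
  then have "0 \<le> ln ((1 + \<rho>) / (1 - \<rho>))" using \<rho> by (intro ln_ge_zero) (simp add: field_simps)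
  then show ?thesis using True by (simp add: hyperbolic_dist_def)
next
  case False
  have \<rho>0: "0 \<le> \<rho>" using p norm_ge_zero[of p] by linarith
  define R where "R = (1 + \<rho>) / (1 - \<rho>)"
  have R: "1 \<le> R" using \<rho> \<rho>0 by (simp add: R_def field_simps)
  define u where "u = (1 / norm (p - q)) *\<^sub>R (p - q)"
  define s where "s = p \<bullet> u"
  define t where "t = s - norm (p - q)"
  define m where "m = p - s *\<^sub>R u"
  have u: "norm u = 1" using False by (simp add: u_def)
  have mu: "m \<bullet> u = 0" using u by (simp add: m_def s_def inner_diff_left norm_eq_1)
  have pm: "p = m + s *\<^sub>R u" by (simp add: m_def)
  have "norm (p - q) *\<^sub>R u = p - q" using False by (simp add: u_def)
  then have qm: "q = m + t *\<^sub>R u" by (simp add: m_def t_def algebra_simps)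
  have st: "s \<noteq> t" using False by (simp add: t_def)
  have nm: "(norm (m + x *\<^sub>R u))\<^sup>2 = (norm m)\<^sup>2 + x\<^sup>2" for x
    using u mu unfolding power2_norm_eq_inner norm_eq_1
    by (simp add: inner_add_left inner_add_right inner_commute power2_eq_square)
  have \<rho>2: "\<rho>\<^sup>2 < 1" using \<rho> \<rho>0 by (simp add: abs_square_less_1)
  have bd: "(norm m)\<^sup>2 + s\<^sup>2 \<le> \<rho>\<^sup>2" "(norm m)\<^sup>2 + t\<^sup>2 \<le> \<rho>\<^sup>2"
    using p q \<rho>0 unfolding nm[symmetric] pm[symmetric] qm[symmetric] by (auto intro!: power_mono)
  then have m1: "(norm m)\<^sup>2 < 1" using \<rho>2 zero_le_power2[of s] by linarith
  define l where "l = sqrt (1 - (norm m)\<^sup>2)"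
  have l: "0 < l" "l\<^sup>2 = 1 - (norm m)\<^sup>2" using m1 by (auto simp: l_def)
  have le: "\<bar>x\<bar> \<le> \<rho> * l" if "(norm m)\<^sup>2 + x\<^sup>2 \<le> \<rho>\<^sup>2" for x
  proof -
    have "\<rho>\<^sup>2 * (norm m)\<^sup>2 \<le> 1 * (norm m)\<^sup>2" using \<rho>2 by (intro mult_right_mono) auto
    then have "x\<^sup>2 \<le> (\<rho> * l)\<^sup>2" using that unfolding power_mult_distrib l(2) by (simp add: algebra_simps)
    then show ?thesis using \<rho>0 l(1) abs_le_square_iff[of x "\<rho> * l"] by simp
  qed
  have lt: "\<bar>x\<bar> < l" if "\<bar>x\<bar> \<le> \<rho> * l" for x
    using that l(1) \<rho> mult_strict_right_mono[OF \<rho> l(1)] by linarith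
  have ub: "(l + x) / (l - x) \<le> R" if "\<bar>x\<bar> \<le> \<rho> * l" for x
  proof -
    have "(l + x) * (1 - \<rho>) \<le> (1 + \<rho>) * (l - x)" using that by (simp add: algebra_simps abs_le_iff)
    then show ?thesis unfolding R_def using lt[OF that] \<rho> by (simp add: field_simps abs_less_iff)
  qed
  have ln_ub: "\<bar>ln ((l + x) / (l - x))\<bar> \<le> ln R" if "\<bar>x\<bar> \<le> \<rho> * l" for x
  proof -
    have *: "ln ((l + x) / (l - x)) \<le> ln R" if "\<bar>x\<bar> \<le> \<rho> * l" for x
      using ub[OF that] lt[OF that] R by (subst ln_le_cancel_iff) (auto simp: abs_less_iff)
    have "ln ((l - x) / (l + x)) = - ln ((l + x) / (l - x))"
      using lt[OF that] by (auto simp: ln_div abs_less_iff)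
    then show ?thesis using *[of x] *[of "- x"] that by (simp add: abs_le_iff)
  qed
  have s: "\<bar>s\<bar> \<le> \<rho> * l" and t: "\<bar>t\<bar> \<le> \<rho> * l" using le bd by auto
  have "ln ((l + s) * (l - t) / ((l - s) * (l + t))) = ln ((l + s) / (l - s)) - ln ((l + t) / (l - t))"
    using lt[OF s] lt[OF t] by (simp add: ln_div ln_mult abs_less_iff)
  then have "1 / 2 * \<bar>ln ((l + s) * (l - t) / ((l - s) * (l + t)))\<bar> \<le> ln R"
    using ln_ub[OF s] ln_ub[OF t] by (simp add: abs_le_iff)
  then show ?thesis
    using hyperbolic_dist_chord[OF u mu l lt[OF s] lt[OF t] st]
    unfolding pm[symmetric] qm[symmetric] R_def by simp
qed

lemma hyperbolic_diam_lessD: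
  fixes K :: "(real ^ 'n) set"
  assumes K: "interior K \<noteq> {}" "K \<subseteq> cball 0 1" and diam: "hyperbolic_diam K < ereal D"
  shows "K \<subseteq> ball 0 1" "\<And>p q. p \<in> K \<Longrightarrow> q \<in> K \<Longrightarrow> hyperbolic_dist p q < ereal D"
proof -
  show less: "hyperbolic_dist p q < ereal D" if "p \<in> K" "q \<in> K" for p q
  proof -
    have "hyperbolic_dist p q \<le> hyperbolic_diam K"
      unfolding hyperbolic_diam_def using that by (intro SUP_upper2[of p] SUP_upper2[of q]) auto
    then show ?thesis using diam by (rule le_less_trans)
  qed
  show "K \<subseteq> ball 0 1"
  proof
    fix p assume p: "p \<in> K"
    have "K \<noteq> {p}" using K(1) by auto
    then obtain q where q: "q \<in> K" "q \<noteq> p" using p by blast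
    have "norm p < 1"
    proof (rule ccontr)
      assume "\<not> norm p < 1"
      then have "hyperbolic_dist p q = \<infinity>" using q by (simp add: hyperbolic_dist_def)
      then show False using less[OF p q(1)] by simp
    qed
    then show "p \<in> ball 0 1" by simp
  qed
qed

section \<open>Uniqueness\<close>

text \<open>Just after \<open>a\<close> the function is negative.  At the next zero it would have to arrive from above, so
  by the intermediate value theorem there would be an even earlier zero.\<close>
lemma no_two_zeros_if_decreasing_at_zeros:
  fixes f f' :: "real \<Rightarrow> real"
  assumes ab: "a < b" and der: "\<And>t. a \<le> t \<Longrightarrow> t \<le> b \<Longrightarrow> (f has_real_derivative f' t) (at t)"
    and neg: "\<And>t. a \<le> t \<Longrightarrow> t \<le> b \<Longrightarrow> f t = 0 \<Longrightarrow> f' t < 0"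
    and zeros: "f a = 0" "f b = 0"
  shows False
proof -
  have cont: "continuous_on {a..b} f"
    using der by (intro DERIV_continuous_on) (auto intro: has_field_derivative_at_within)
  obtain h where h: "h > 0" "\<And>x. 0 < x \<Longrightarrow> x < h \<Longrightarrow> f (a + x) < 0"
    using DERIV_neg_dec_right[OF der neg, of a] ab zeros by auto
  define e0 where "e0 = min h (b - a) / 2"
  have e0: "0 < e0" "e0 < h" "e0 < b - a" using h(1) ab by (auto simp: e0_def min_def)
  define Z where "Z = {t \<in> {a + e0..b}. f t = 0}"
  have cZ: "compact Z"
  proof -
    have "closed ({a + e0..b} \<inter> f -` {0})"
      using e0 by (intro continuous_closed_preimage continuous_on_subset[OF cont]) auto
    moreover have "bounded Z" unfolding Z_def by (rule bounded_subset[OF bounded_closed_interval]) auto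
    moreover have "Z = {a + e0..b} \<inter> f -` {0}" unfolding Z_def by auto
    ultimately show ?thesis by (simp add: compact_eq_bounded_closed)
  qed
  have "b \<in> Z" using zeros e0 by (simp add: Z_def)
  then obtain z where z: "z \<in> Z" "\<And>t. t \<in> Z \<Longrightarrow> z \<le> t"
    using compact_attains_inf[OF cZ] by blast
  define c where "c = a + e0"
  have c: "a < c" "c < b" "f c < 0"
    using h(2)[of e0] e0 by (auto simp: c_def)
  have zz: "c \<le> z" "z \<le> b" "f z = 0" using z(1) by (auto simp: Z_def c_def)
  then have "c < z" using c by (cases "c = z") auto
  obtain k where k: "k > 0" "\<And>x. 0 < x \<Longrightarrow> x < k \<Longrightarrow> 0 < f (z - x)"
    using DERIV_neg_dec_left[OF der neg, of z] zz c by auto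
  define e where "e = min k (z - c) / 2"
  have e: "0 < e" "e < k" "c < z - e" using k \<open>c < z\<close> by (auto simp: e_def min_def field_simps)
  have "continuous_on {c..z - e} f" using c zz e by (intro continuous_on_subset[OF cont]) auto
  then obtain x where "c \<le> x" "x \<le> z - e" "f x = 0"
    using IVT'[of f c 0 "z - e"] c k(2)[OF e(1,2)] e(3) by auto
  then have "x \<in> Z" using zz e by (auto simp: Z_def c_def)
  with z(2)[of x] \<open>x \<le> z - e\<close> e show False by simp
qed

text \<open>The term on the left is the derivative of the gap along \<open>u\<close>, that is, minus the second derivative
  of the potential.  A vanishing gap means that both polars have the same mean in direction \<open>u\<close>; then the
  sign is that of the ball's variance minus the variance of \<open>W\<close>, and this is decided by the widths.\<close>
lemma centroid_gap_decreasing_at_zero: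
  fixes K :: "(real ^ 'n) set" and x u :: "real ^ 'n"
  assumes Kc: "compact K" "convex K" "K \<subseteq> ball 0 1"
    and hyp: "\<And>p q. p \<in> K \<Longrightarrow> q \<in> K \<Longrightarrow> hyperbolic_dist p q < ereal (ln ((1 + r) / (1 - r)))"
    and r: "0 < r" "r < 1" "r\<^sup>2 = 2 / (real CARD('n) + 1)"
    and x: "x \<in> interior K" and u: "norm u = 1" and zero: "centroid_gap K u x = 0"
  shows "- polar_moment K u 2 x / polar_moment K u 0 x + (polar_moment K u 1 x / polar_moment K u 0 x)\<^sup>2
    + (real DIM(real ^ 'n) + 1) * (u \<bullet> u / (1 - (norm x)\<^sup>2) + 2 * (x \<bullet> u / (1 - (norm x)\<^sup>2))\<^sup>2) < 0"
proof -
  interpret interior_point K x by unfold_locales fact+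
  define d where "d = real CARD('n)"
  have d: "0 \<le> d" by (simp add: d_def)
  define E where "E = 1 - (norm x)\<^sup>2"
  define \<beta> where "\<beta> = x \<bullet> u / E"
  define N1 where "N1 = polar_moment K u 1 x / polar_moment K u 0 x"
  define N2 where "N2 = polar_moment K u 2 x / polar_moment K u 0 x"
  have nx: "norm x < 1" using x Kc(3) interior_subset[of K] by auto
  have "u \<noteq> 0" using u by auto
  from extreme_points_W[OF this] obtain p q where pq: "p \<in> W" "q \<in> W"
    "\<And>w. w \<in> W \<Longrightarrow> u \<bullet> w \<le> u \<bullet> p" "\<And>w. w \<in> W \<Longrightarrow> u \<bullet> q \<le> u \<bullet> w" "0 < u \<bullet> p" "u \<bullet> q < 0" by blast
  have k1: "x - (1 / (u \<bullet> p)) *\<^sub>R u \<in> K"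
    using pq by (intro chord_point_in_K Kc) auto
  have "x - (1 / (- (u \<bullet> q))) *\<^sub>R (- u) \<in> K"
    using pq by (intro chord_point_in_K Kc) auto
  then have k2: "x + (1 / (- (u \<bullet> q))) *\<^sub>R u \<in> K" by simp
  have "4 * (\<beta>\<^sup>2 + 1 / E) < r\<^sup>2 * (u \<bullet> p + - (u \<bullet> q))\<^sup>2"
    unfolding \<beta>_def E_def
    using pq(5,6) k1 k2 Kc(3) hyp[OF k2 k1]
    by (intro hyperbolic_dist_less_imp_width[OF u nx _ _ r(1,2)]) auto
  then have "4 * (\<beta>\<^sup>2 + 1 / E) < 2 * (u \<bullet> p - u \<bullet> q)\<^sup>2 / (d + 1)"
    unfolding r(3) d_def by simp
  moreover have "2 * (u \<bullet> p - u \<bullet> q)\<^sup>2 / (d + 1) = 4 * ((u \<bullet> p - u \<bullet> q)\<^sup>2 / 2 / (d + 1))"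
    by (simp del: divide_divide_eq_left)
  ultimately have "4 * (\<beta>\<^sup>2 + 1 / E) < 4 * ((u \<bullet> p - u \<bullet> q)\<^sup>2 / 2 / (d + 1))" by (simp only:)
  then have "\<beta>\<^sup>2 + 1 / E < (u \<bullet> p - u \<bullet> q)\<^sup>2 / 2 / (d + 1)"
    by (rule mult_left_less_imp_less) simp
  then have width: "(d + 1) * (\<beta>\<^sup>2 + 1 / E) < (u \<bullet> p - u \<bullet> q)\<^sup>2 / 2"
    using d by (subst (asm) pos_less_divide_eq) (auto simp: mult.commute)
  have var: "(u \<bullet> p - u \<bullet> q)\<^sup>2 / 2 + (d + 2) / (d + 1) * N1\<^sup>2 \<le> N2"
    using variance_W_ge[OF pq(1-4)] by (simp add: N1_def N2_def d_def)
  have N1: "N1 = - ((d + 1) * \<beta>)"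
    using zero by (simp add: centroid_gap_def N1_def d_def \<beta>_def E_def)
  have "(d + 2) / (d + 1) * N1\<^sup>2 = (d + 2) * (d + 1) * \<beta>\<^sup>2"
    using d unfolding N1 by (simp add: power2_eq_square)
  then have "(d + 1) * (\<beta>\<^sup>2 + 1 / E) + (d + 2) * (d + 1) * \<beta>\<^sup>2 < N2"
    using less_le_trans[OF add_strict_right_mono[OF width] var] by (simp only:)
  then have "- N2 + N1\<^sup>2 + (d + 1) * (1 / E + 2 * \<beta>\<^sup>2) < 0"
    unfolding N1 by (simp add: power2_eq_square algebra_simps)
  moreover have "u \<bullet> u = 1" using u by (simp add: norm_eq_1)
  ultimately show ?thesis
    by (simp add: N1_def N2_def d_def E_def \<beta>_def)
qed

text \<open>Two solutions would be two zeros of the gap along the segment that joins them.\<close>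
lemma centroid_gap_zero_unique:
  fixes K :: "(real ^ 'n) set"
  assumes K: "compact K" "convex K" "K \<subseteq> ball 0 1"
    and hyp: "\<And>p q. p \<in> K \<Longrightarrow> q \<in> K \<Longrightarrow> hyperbolic_dist p q < ereal (ln ((1 + r) / (1 - r)))"
    and r: "0 < r" "r < 1" "r\<^sup>2 = 2 / (real CARD('n) + 1)"
    and y: "y \<in> interior K" "\<And>u. centroid_gap K u y = 0"
    and z: "z \<in> interior K" "\<And>u. centroid_gap K u z = 0"
  shows "y = z"
proof (rule ccontr)
  assume "y \<noteq> z"
  define T where "T = norm (z - y)"
  define u where "u = (1 / T) *\<^sub>R (z - y)"
  have T: "0 < T" using \<open>y \<noteq> z\<close> by (simp add: T_def)
  have u: "norm u = 1" using T by (simp add: u_def T_def)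
  have zy: "y + T *\<^sub>R u = z" using T by (simp add: u_def)
  have int: "y + t *\<^sub>R u \<in> interior K" if "0 \<le> t" "t \<le> T" for t
  proof -
    have "y + t *\<^sub>R u = (1 - t / T) *\<^sub>R y + (t / T) *\<^sub>R z"
      using T by (simp add: zy[symmetric] algebra_simps)
    then show ?thesis
      using convexD_alt[OF convex_interior[OF K(2)] y(1) z(1), of "t / T"] that T by simp
  qed
  have nrm: "norm (y + t *\<^sub>R u) < 1" if "0 \<le> t" "t \<le> T" for t
    using int[OF that] K(3) interior_subset[of K] by auto
  show False
  proof (rule no_two_zeros_if_decreasing_at_zeros[OF T])
    fix t assume t: "0 \<le> t" "t \<le> T"
    show "((\<lambda>t. centroid_gap K u (y + t *\<^sub>R u)) has_real_derivative
      - polar_moment K u 2 (y + t *\<^sub>R u) / polar_moment K u 0 (y + t *\<^sub>R u)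
      + (polar_moment K u 1 (y + t *\<^sub>R u) / polar_moment K u 0 (y + t *\<^sub>R u))\<^sup>2
      + (real DIM(real ^ 'n) + 1) * (u \<bullet> u / (1 - (norm (y + t *\<^sub>R u))\<^sup>2)
      + 2 * ((y + t *\<^sub>R u) \<bullet> u / (1 - (norm (y + t *\<^sub>R u))\<^sup>2))\<^sup>2)) (at t)"
      by (rule has_derivative_centroid_gap[OF K(1) int[OF t] nrm[OF t]])
    assume "centroid_gap K u (y + t *\<^sub>R u) = 0"
    then show "- polar_moment K u 2 (y + t *\<^sub>R u) / polar_moment K u 0 (y + t *\<^sub>R u)
      + (polar_moment K u 1 (y + t *\<^sub>R u) / polar_moment K u 0 (y + t *\<^sub>R u))\<^sup>2
      + (real DIM(real ^ 'n) + 1) * (u \<bullet> u / (1 - (norm (y + t *\<^sub>R u))\<^sup>2)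
      + 2 * ((y + t *\<^sub>R u) \<bullet> u / (1 - (norm (y + t *\<^sub>R u))\<^sup>2))\<^sup>2) < 0"
      by (intro centroid_gap_decreasing_at_zero[OF K hyp r int[OF t] u])
  qed (use y z zy in auto)
qed

section \<open>Existence\<close>

lemma polar_moment_0_eq: "polar_moment K u 0 y = polar_moment K 0 0 y"
  by (simp add: polar_moment_def)

lemma convex_on_polar_moment_0:
  fixes K :: "'a::euclidean_space set"
  assumes K: "compact K" "convex K"
  shows "convex_on (interior K) (polar_moment K 0 0)"
proof (rule convex_onI)
  fix t :: real and x y :: 'a
  assume t: "0 < t" "t < 1" and xy: "x \<in> interior K" "y \<in> interior K"
  let ?z = "(1 - t) *\<^sub>R x + t *\<^sub>R y"
  have z: "?z \<in> interior K"
    using convexD_alt[OF convex_interior[OF K(2)] xy, of t] t by simp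
  interpret x: interior_point K x using K(1) xy(1) by (rule interior_point.intro)
  interpret y: interior_point K y using K(1) xy(2) by (rule interior_point.intro)
  interpret z: interior_point K ?z using K(1) z by (rule interior_point.intro)
  have ix: "integrable lborel (\<lambda>w. (1 - t) * exp (- polar_gauge K x w))"
    and iy: "integrable lborel (\<lambda>w. t * exp (- polar_gauge K y w))"
    using x.moment_integrable[of 0 0] y.moment_integrable[of 0 0] by auto
  have "polar_moment K 0 0 ?z \<le> (LINT w|lborel. (1 - t) * exp (- polar_gauge K x w) + t * exp (- polar_gauge K y w))"
    unfolding polar_moment_def
  proof (rule integral_mono)
    show "integrable lborel (\<lambda>w. (0 \<bullet> w) ^ 0 * exp (- polar_gauge K ?z w))"
      by (rule z.moment_integrable)
    show "integrable lborel (\<lambda>w. (1 - t) * exp (- polar_gauge K x w) + t * exp (- polar_gauge K y w))"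
      by (rule Bochner_Integration.integrable_add[OF ix iy])
    fix w :: 'a
    have tr: "polar_gauge K v w = polar_gauge K 0 w + w \<bullet> v" for v
      using polar_gauge_translate[OF K(1) x.ne, of 0 v w] by simp
    have "- polar_gauge K ?z w = (1 - t) *\<^sub>R (- polar_gauge K x w) + t *\<^sub>R (- polar_gauge K y w)"
      unfolding tr[of ?z] tr[of x] tr[of y] by (simp add: inner_add_right algebra_simps)
    then show "(0 \<bullet> w) ^ 0 * exp (- polar_gauge K ?z w)
      \<le> (1 - t) * exp (- polar_gauge K x w) + t * exp (- polar_gauge K y w)"
      using convex_onD[OF exp_convex, of t "- polar_gauge K x w" "- polar_gauge K y w"] t by simp
  qed
  also have "\<dots> = (1 - t) * polar_moment K 0 0 x + t * polar_moment K 0 0 y"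
    unfolding Bochner_Integration.integral_add[OF ix iy] by (simp add: polar_moment_def)
  finally show "polar_moment K 0 0 ?z \<le> (1 - t) * polar_moment K 0 0 x + t * polar_moment K 0 0 y" .
qed (use K in \<open>simp add: convex_interior\<close>)

context interior_point
begin

text \<open>If \<open>y\<close> has distance at most \<open>\<epsilon>\<close> to the complement of \<open>K\<close>, then \<open>W\<close> contains a point at distance at least
  \<open>1 / \<epsilon>\<close> from the origin.  It also contains a fixed ball about the origin, hence by convexity
  half-size balls along the way to the midpoint of that segment; those of them at unit distances are
  disjoint.\<close>
lemma measure_W_near_boundary:
  assumes "convex K" and diam: "\<And>z. z \<in> K \<Longrightarrow> dist y z \<le> 2"
    and \<epsilon>: "0 < \<epsilon>" "\<not> cball y \<epsilon> \<subseteq> K" and m: "2 * real m * \<epsilon> \<le> 1"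
  shows "real m * measure lborel (ball (0::'a) (1 / 4)) \<le> measure lborel W"
proof -
  have half: "cball 0 (1 / 2) \<subseteq> W" by (rule ball_subset_W) (auto intro: diam)
  then have W0: "0 \<in> W" by (rule subsetD) simp
  obtain z where z: "dist y z \<le> \<epsilon>" "z \<notin> K"
    using \<epsilon>(2) unfolding subset_iff mem_cball by blast
  obtain e b where eb: "e \<bullet> z < b" "\<And>x. x \<in> K \<Longrightarrow> b < e \<bullet> x"
    using separating_hyperplane_closed_point[OF assms(1) compact_imp_closed[OF K] z(2)] by metis
  define g where "g = e \<bullet> y - b"
  have g: "0 < g" using eb(2)[of y] mem interior_subset by (auto simp: g_def)
  have "g \<le> e \<bullet> (y - z)" using eb(1) by (simp add: g_def inner_diff_right)
  also have "\<dots> \<le> norm e * norm (y - z)" by (rule norm_cauchy_schwarz)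
  also have "\<dots> \<le> norm e * \<epsilon>" using z(1) by (intro mult_left_mono) (auto simp: dist_norm)
  finally have ge: "g \<le> norm e * \<epsilon>" .
  then have "e \<noteq> 0" using g by auto
  define v where "v = (1 / norm e) *\<^sub>R e"
  have v: "norm v = 1" using \<open>e \<noteq> 0\<close> by (simp add: v_def)
  have e_W: "((1 / g) *\<^sub>R e) \<in> W"
  proof -
    have "((1 / g) *\<^sub>R e) \<bullet> (y - x) \<le> 1" if "x \<in> K" for x
    proof -
      have "e \<bullet> (y - x) \<le> g" using eb(2)[OF that] by (simp add: inner_diff_right g_def)
      then show ?thesis using g by simp
    qed
    then show ?thesis by (simp add: polar_gauge_le_iff[OF K ne])
  qed
  have seg: "(2 * real j) *\<^sub>R v \<in> W" if "j < m" for j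
  proof -
    have "2 * real j * g \<le> 2 * real m * (norm e * \<epsilon>)"
      using that ge g by (intro mult_mono) auto
    also have "\<dots> = (2 * real m * \<epsilon>) * norm e" by simp
    also have "\<dots> \<le> 1 * norm e" using m by (intro mult_right_mono) auto
    finally have "2 * real j * g / norm e \<le> 1" using \<open>e \<noteq> 0\<close> by simp
    moreover have "(2 * real j) *\<^sub>R v = (1 - 2 * real j * g / norm e) *\<^sub>R 0 + (2 * real j * g / norm e) *\<^sub>R ((1 / g) *\<^sub>R e)"
      using g by (simp add: v_def)
    ultimately show ?thesis
      using convexD_alt[OF convex_W W0 e_W, of "2 * real j * g / norm e"] g by simp
  qed
  define A where "A j = ball (real j *\<^sub>R v) (1 / 4)" for j :: nat
  have sub: "A j \<subseteq> W" if "j < m" for j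
  proof
    fix x assume "x \<in> A j"
    then have "norm (x - real j *\<^sub>R v) < 1 / 4" by (simp add: A_def dist_norm norm_minus_commute)
    then have "2 *\<^sub>R (x - real j *\<^sub>R v) \<in> cball 0 (1 / 2)" by simp
    then have "2 *\<^sub>R (x - real j *\<^sub>R v) \<in> W" using half by blast
    from convexD_alt[OF convex_W this seg[OF that], of "1 / 2"]
    show "x \<in> W" by (simp add: scaleR_diff_right)
  qed
  have "disjoint_family_on A {..<m}"
    unfolding disjoint_family_on_def
  proof (intro ballI impI)
    fix i j :: nat assume "i \<noteq> j"
    have "1 \<le> \<bar>real i - real j\<bar>" using \<open>i \<noteq> j\<close> by (simp add: abs_if)
    then have "1 \<le> dist (real i *\<^sub>R v) (real j *\<^sub>R v)"
      using v by (simp add: dist_norm flip: scaleR_left_diff_distrib)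
    then show "A i \<inter> A j = {}" unfolding A_def by (intro disjoint_ballI) simp
  qed
  then have "measure lborel (\<Union>j<m. A j) = (\<Sum>j<m. measure lborel (A j))"
  proof (intro measure_finite_Union)
    show "A ` {..<m} \<subseteq> sets lborel" by (auto simp: A_def)
    show "emeasure lborel (A j) \<noteq> \<infinity>" for j
      using emeasure_bounded_finite[of "A j"] by (auto simp: A_def)
  qed auto
  also have "\<dots> = real m * measure lborel (ball (0::'a) (1 / 4))"
    by (simp add: A_def content_ball)
  finally have "real m * measure lborel (ball (0::'a) (1 / 4)) = measure lborel (\<Union>j<m. A j)" by simp
  also have "\<dots> \<le> measure lborel W"
    using sub measure_W(2) compact_W
    by (intro measure_mono_fmeasurable fmeasurableI) (auto simp: A_def borel_compact)
  finally show ?thesis .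
qed

end

text \<open>Up to an additive constant, the logarithm of the quotient of the volumes of the two polars: the
  volume of the polar of the unit ball is proportional to \<open>(1 - |y|\<^sup>2) powr (- (d + 1) / 2)\<close>.\<close>
definition polar_potential :: "'a::euclidean_space set \<Rightarrow> 'a \<Rightarrow> real" where
  "polar_potential K y = ln (polar_moment K 0 0 y) + (real DIM('a) + 1) / 2 * ln (1 - (norm y)\<^sup>2)"

lemma has_derivative_polar_potential:
  assumes K: "compact K" and y: "y \<in> interior K" "norm y < 1"
  shows "((\<lambda>t. polar_potential K (y + t *\<^sub>R u)) has_real_derivative - centroid_gap K u y) (at 0)"
proof -
  interpret interior_point K y using assms by unfold_locales
  have "(norm y)\<^sup>2 < 1" using y(2) by (simp add: abs_square_less_1)
  then have E: "0 < 1 - y \<bullet> y" by (simp add: power2_norm_eq_inner)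
  have D0: "((\<lambda>t. polar_moment K 0 0 (y + t *\<^sub>R u)) has_real_derivative - polar_moment K u 1 y) (at 0)"
    using has_derivative_moment_0[of u 0] by (simp add: polar_moment_0_eq[of K u])
  have D1: "((\<lambda>t. 1 - (y + t *\<^sub>R u) \<bullet> (y + t *\<^sub>R u)) has_real_derivative - 2 * (y \<bullet> u)) (at 0)"
    by (auto simp: inner_add_left inner_add_right inner_commute algebra_simps intro!: derivative_eq_intros)
  have L0: "((\<lambda>t. ln (polar_moment K 0 0 (y + t *\<^sub>R u))) has_real_derivative
      inverse (polar_moment K 0 0 (y + 0 *\<^sub>R u)) * - polar_moment K u 1 y) (at 0)"
    using moment_0_pos[of 0] by (intro DERIV_chain2[OF DERIV_ln D0]) simp
  have L1: "((\<lambda>t. ln (1 - (y + t *\<^sub>R u) \<bullet> (y + t *\<^sub>R u))) has_real_derivative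
      inverse (1 - (y + 0 *\<^sub>R u) \<bullet> (y + 0 *\<^sub>R u)) * (- 2 * (y \<bullet> u))) (at 0)"
    using E by (intro DERIV_chain2[OF DERIV_ln D1]) simp
  have "inverse (polar_moment K 0 0 (y + 0 *\<^sub>R u)) * - polar_moment K u 1 y
      + (real DIM('a) + 1) / 2 * (inverse (1 - (y + 0 *\<^sub>R u) \<bullet> (y + 0 *\<^sub>R u)) * (- 2 * (y \<bullet> u)))
      = - centroid_gap K u y"
    by (simp add: centroid_gap_def polar_moment_0_eq[of K u] power2_norm_eq_inner inverse_eq_divide)
  then show ?thesis
    using DERIV_add[OF L0 DERIV_cmult[OF L1, of "(real DIM('a) + 1) / 2"]]
    by (simp only: polar_potential_def[abs_def] power2_norm_eq_inner)
qed

text \<open>Outside the compact set \<open>C\<close> of the points with distance at least \<open>\<epsilon>\<close> to the boundary the potential exceeds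
  its value at some fixed point, so its minimum over \<open>C\<close> is a minimum over \<open>interior K\<close>.\<close>
lemma centroid_gap_zero_exists:
  fixes K :: "'a::euclidean_space set"
  assumes Kc: "compact K" "convex K" "K \<subseteq> ball 0 1" "interior K \<noteq> {}"
  obtains y where "y \<in> interior K" "\<And>u. centroid_gap K u y = 0"
proof -
  let ?F = "polar_potential K"
  have nrm: "norm y < 1" if "y \<in> K" for y using Kc(3) that by auto
  have "K \<noteq> {}" using Kc(4) interior_subset by auto
  then obtain y1 where y1: "y1 \<in> K" "\<And>y. y \<in> K \<Longrightarrow> norm y \<le> norm y1"
    using continuous_attains_sup[OF Kc(1) _ continuous_on_norm_id] by blast
  define c where "c = 1 - (norm y1)\<^sup>2"
  have c: "0 < c" "\<And>y. y \<in> K \<Longrightarrow> c \<le> 1 - (norm y)\<^sup>2"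
    using nrm[OF y1(1)] y1(2) by (auto simp: c_def abs_square_less_1 intro!: power_mono)
  define B where "B = fact DIM('a) * measure lborel (ball (0::'a) (1 / 4))"
  have B: "0 < B" using content_ball_pos[of "1/4" "0::'a"] by (simp add: B_def)
  obtain y2 where y2: "y2 \<in> interior K" using Kc(4) by blast
  define d where "d = real DIM('a)"
  obtain m :: nat where m: "exp (?F y2 - (d + 1) / 2 * ln c) / B < m"
    using reals_Archimedean2 by blast
  have m0: "0 < real m" using less_trans[OF divide_pos_pos[OF exp_gt_zero B] m] .
  define \<epsilon> where "\<epsilon> = 1 / (2 * real m)"
  have \<epsilon>: "0 < \<epsilon>" "2 * real m * \<epsilon> \<le> 1" using m0 by (auto simp: \<epsilon>_def)
  define C where "C = {y. cball y \<epsilon> \<subseteq> K}"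
  have big: "?F y2 < ?F y" if y: "y \<in> interior K" "y \<notin> C" for y
  proof -
    interpret interior_point K y using Kc(1) y(1) by (rule interior_point.intro)
    have yK: "y \<in> K" using y interior_subset by auto
    have "dist y z \<le> 2" if "z \<in> K" for z
      using nrm[OF yK] nrm[OF that] norm_triangle_ineq4[of y z] by (simp add: dist_norm)
    then have "real m * measure lborel (ball (0::'a) (1 / 4)) \<le> measure lborel W"
      using y(2) \<epsilon> by (intro measure_W_near_boundary[OF Kc(2) _ \<epsilon>(1)]) (auto simp: C_def)
    then have "m * B \<le> polar_moment K 0 0 y"
      unfolding moment_0 B_def by (simp add: mult.left_commute)
    moreover have "exp (?F y2 - (d + 1) / 2 * ln c) < m * B"
      using m B by (simp add: pos_divide_less_eq)
    ultimately have less: "exp (?F y2 - (d + 1) / 2 * ln c) < polar_moment K 0 0 y" by simp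
    have "?F y2 - (d + 1) / 2 * ln c < ln (polar_moment K 0 0 y)"
    proof -
      have "exp (?F y2 - (d + 1) / 2 * ln c) < exp (ln (polar_moment K 0 0 y))"
        using less moment_0_pos[of 0] by simp
      then show ?thesis by (simp only: exp_less_cancel_iff)
    qed
    moreover have "ln c \<le> ln (1 - (norm y)\<^sup>2)" using c(1) c(2)[OF yK] by simp
    then have "(d + 1) / 2 * ln c \<le> (d + 1) / 2 * ln (1 - (norm y)\<^sup>2)"
      by (intro mult_left_mono) (auto simp: d_def)
    ultimately show ?thesis unfolding polar_potential_def[of K y] d_def[symmetric] by linarith
  qed
  have CK: "C \<subseteq> interior K"
  proof
    fix y assume "y \<in> C"
    then show "y \<in> interior K" using \<epsilon>(1) by (auto simp: C_def mem_interior_cball)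
  qed
  have y2C: "y2 \<in> C" using big[OF y2] by blast
  have "compact C"
  proof -
    have "C = (\<Inter>h\<in>cball 0 \<epsilon>. (\<lambda>y. y + h) -` K)"
    proof (intro set_eqI iffI)
      fix y assume "y \<in> C"
      then show "y \<in> (\<Inter>h\<in>cball 0 \<epsilon>. (\<lambda>y. y + h) -` K)"
        by (auto simp: C_def subset_iff dist_norm)
    next
      fix y assume *: "y \<in> (\<Inter>h\<in>cball 0 \<epsilon>. (\<lambda>y. y + h) -` K)"
      have "z \<in> K" if "z \<in> cball y \<epsilon>" for z
      proof -
        have "z - y \<in> cball 0 \<epsilon>" using that by (simp add: dist_norm norm_minus_commute)
        with * have "y + (z - y) \<in> K" by blast
        then show ?thesis by simp
      qed
      then show "y \<in> C" by (auto simp: C_def)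
    qed
    moreover have "closed ((\<lambda>y. y + h) -` K)" for h
      by (intro continuous_closed_vimage compact_imp_closed Kc(1)) (auto intro!: continuous_intros)
    ultimately have "closed C" by (simp add: closed_INT)
    moreover have "bounded C"
      using CK interior_subset[of K] compact_imp_bounded[OF Kc(1)] by (meson bounded_subset order_trans)
    ultimately show ?thesis by (simp add: compact_eq_bounded_closed)
  qed
  have "continuous_on C ?F"
  proof -
    have "continuous_on C (polar_moment K 0 0)"
      using convex_on_continuous[OF open_interior convex_on_polar_moment_0[OF Kc(1,2)]] CK
      by (rule continuous_on_subset)
    moreover have "polar_moment K 0 0 y \<noteq> 0" if "y \<in> C" for y
      using interior_point.moment_0_pos[OF interior_point.intro[OF Kc(1) subsetD[OF CK that]], of 0] by simp
    moreover have "1 - (norm y)\<^sup>2 \<noteq> 0" if "y \<in> C" for y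
      using c(1) c(2)[of y] that CK interior_subset[of K] by force
    ultimately show ?thesis
      unfolding polar_potential_def[abs_def] by (intro continuous_intros) auto
  qed
  then obtain y where y: "y \<in> C" "\<And>z. z \<in> C \<Longrightarrow> ?F y \<le> ?F z"
    using continuous_attains_inf[OF \<open>compact C\<close>] y2C by blast
  have yint: "y \<in> interior K" using y(1) CK by blast
  have min: "?F y \<le> ?F z" if "z \<in> interior K" for z
    using y(2)[of z] y(2)[OF y2C] big[OF that] by (cases "z \<in> C") auto
  have "centroid_gap K u y = 0" for u
  proof -
    obtain e where e: "0 < e" "cball y e \<subseteq> interior K"
      using yint by (meson open_contains_cball open_interior)
    have D: "((\<lambda>t. ?F (y + t *\<^sub>R u)) has_real_derivative - centroid_gap K u y) (at 0)"
      using yint nrm interior_subset[of K] by (intro has_derivative_polar_potential Kc(1)) auto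
    have "- centroid_gap K u y = 0"
    proof (rule DERIV_local_min[OF D])
      show "0 < e / (norm u + 1)" using e by (simp add: add_nonneg_pos)
      show "\<forall>t. \<bar>0 - t\<bar> < e / (norm u + 1) \<longrightarrow> ?F (y + 0 *\<^sub>R u) \<le> ?F (y + t *\<^sub>R u)"
      proof (intro allI impI)
        fix t assume "\<bar>0 - t\<bar> < e / (norm u + 1)"
        then have "\<bar>t\<bar> * (norm u + 1) < e"
          by (simp add: pos_less_divide_eq add_nonneg_pos)
        moreover have "\<bar>t\<bar> * norm u \<le> \<bar>t\<bar> * (norm u + 1)" by (intro mult_left_mono) auto
        ultimately have "y + t *\<^sub>R u \<in> interior K" using e(2) by (intro subsetD[OF e(2)]) (simp add: dist_norm)
        then show "?F (y + 0 *\<^sub>R u) \<le> ?F (y + t *\<^sub>R u)" using min by simp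
      qed
    qed
    then show ?thesis by simp
  qed
  with yint show ?thesis by (rule that)
qed

section \<open>Boxes\<close>

lemma nn_integral_exp_Ici:
  assumes "0 < (a :: real)"
  shows "(\<integral>\<^sup>+x. ennreal (exp (- (a * x))) * indicator {0..} x \<partial>lborel) = ennreal (1 / a)"
proof -
  have "(\<integral>\<^sup>+x. ennreal (exp (- (a * x))) * indicator {0..} x \<partial>lborel)
      = ennreal (0 - (- (exp (- (a * 0)) / a)))"
  proof (rule nn_integral_FTC_atLeast)
    have "filterlim (\<lambda>x. - (a * x)) at_bot at_top"
      using assms by real_asymp
    then have "((\<lambda>x. exp (- (a * x))) \<longlongrightarrow> 0) at_top"
      by (rule filterlim_compose[OF exp_at_bot])
    then show "((\<lambda>x. - (exp (- (a * x)) / a)) \<longlongrightarrow> 0) at_top"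
      using tendsto_divide[OF _ tendsto_const, of _ 0 at_top a] tendsto_minus assms by fastforce
  qed (use assms in \<open>auto intro!: derivative_eq_intros\<close>)
  then show ?thesis by simp
qed

lemma nn_integral_two_sided_exp:
  fixes h t :: real
  assumes "\<bar>t\<bar> < h"
  shows "(\<integral>\<^sup>+x. ennreal (exp (- (h * \<bar>x\<bar> + x * t))) \<partial>lborel) = ennreal (2 * h / (h\<^sup>2 - t\<^sup>2))"
proof -
  let ?f = "\<lambda>x. ennreal (exp (- (h * \<bar>x\<bar> + x * t)))"
  have "(\<integral>\<^sup>+x. ?f x \<partial>lborel) = (\<integral>\<^sup>+x. ?f x * indicator {0..} x + ?f x * indicator {..<0} x \<partial>lborel)"
    by (intro nn_integral_cong) (auto simp: indicator_def)
  also have "\<dots> = (\<integral>\<^sup>+x. ?f x * indicator {0..} x \<partial>lborel) + (\<integral>\<^sup>+x. ?f x * indicator {..<0} x \<partial>lborel)"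
    by (intro nn_integral_add) measurable
  also have "(\<integral>\<^sup>+x. ?f x * indicator {0..} x \<partial>lborel) = (\<integral>\<^sup>+x. ennreal (exp (- ((h + t) * x))) * indicator {0..} x \<partial>lborel)"
    by (intro nn_integral_cong) (auto simp: indicator_def algebra_simps)
  also have "\<dots> = ennreal (1 / (h + t))" using assms by (intro nn_integral_exp_Ici) auto
  also have "(\<integral>\<^sup>+x. ?f x * indicator {..<0} x \<partial>lborel) = (\<integral>\<^sup>+x. ?f (- x) * indicator {..<0} (- x) \<partial>lborel)"
    using nn_integral_real_affine[of "\<lambda>x. ?f x * indicator {..<0} x" "-1" 0] by simp
  also have "\<dots> = (\<integral>\<^sup>+x. ennreal (exp (- ((h - t) * x))) * indicator {0..} x \<partial>lborel)"
  proof (rule nn_integral_cong_AE, rule AE_mp[OF AE_lborel_singleton[of 0]], intro AE_I2 impI)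
    fix x :: real assume "x \<noteq> 0"
    then show "?f (- x) * indicator {..<0} (- x) = ennreal (exp (- ((h - t) * x))) * indicator {0..} x"
      by (auto simp: indicator_def algebra_simps)
  qed
  also have "\<dots> = ennreal (1 / (h - t))" using assms by (intro nn_integral_exp_Ici) auto
  also have "ennreal (1 / (h + t)) + ennreal (1 / (h - t)) = ennreal (1 / (h + t) + 1 / (h - t))"
    using assms by (intro ennreal_plus[symmetric]) auto
  also have "1 / (h + t) + 1 / (h - t) = 2 * h / (h\<^sup>2 - t\<^sup>2)"
    using assms by (simp add: field_simps power2_eq_square)
  finally show ?thesis .
qed

lemma polar_gauge_box:
  fixes h y w :: "'a::euclidean_space"
  assumes h: "\<And>b. b \<in> Basis \<Longrightarrow> 0 < h \<bullet> b"
  shows "polar_gauge (cbox (- h) h) y w = (\<Sum>b\<in>Basis. (h \<bullet> b) * \<bar>w \<bullet> b\<bar> + (w \<bullet> b) * (y \<bullet> b))"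
proof (rule antisym)
  have "0 \<in> cbox (- h) h" using h by (auto simp: mem_box less_imp_le)
  then have ne: "cbox (- h) h \<noteq> {}" by blast
  show "polar_gauge (cbox (- h) h) y w \<le> (\<Sum>b\<in>Basis. (h \<bullet> b) * \<bar>w \<bullet> b\<bar> + (w \<bullet> b) * (y \<bullet> b))"
    unfolding polar_gauge_le_iff[OF compact_cbox ne]
  proof
    fix z assume z: "z \<in> cbox (- h) h"
    have "w \<bullet> (y - z) = (\<Sum>b\<in>Basis. (w \<bullet> b) * ((y - z) \<bullet> b))" by (rule euclidean_inner)
    also have "\<dots> \<le> (\<Sum>b\<in>Basis. (h \<bullet> b) * \<bar>w \<bullet> b\<bar> + (w \<bullet> b) * (y \<bullet> b))"
    proof (rule sum_mono)
      fix b :: 'a assume b: "b \<in> Basis"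
      have "\<bar>z \<bullet> b\<bar> \<le> h \<bullet> b" using z b by (auto simp: mem_box abs_le_iff)
      then have "\<bar>(w \<bullet> b) * (z \<bullet> b)\<bar> \<le> \<bar>w \<bullet> b\<bar> * (h \<bullet> b)"
        unfolding abs_mult by (intro mult_left_mono) auto
      then show "(w \<bullet> b) * ((y - z) \<bullet> b) \<le> (h \<bullet> b) * \<bar>w \<bullet> b\<bar> + (w \<bullet> b) * (y \<bullet> b)"
        by (simp add: inner_diff_left right_diff_distrib mult.commute)
    qed
    finally show "w \<bullet> (y - z) \<le> (\<Sum>b\<in>Basis. (h \<bullet> b) * \<bar>w \<bullet> b\<bar> + (w \<bullet> b) * (y \<bullet> b))" .
  qed
  define z where "z = (\<Sum>b\<in>Basis. (- (sgn (w \<bullet> b) * (h \<bullet> b))) *\<^sub>R b)"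
  have zb: "z \<bullet> b = - (sgn (w \<bullet> b) * (h \<bullet> b))" if "b \<in> Basis" for b
    unfolding z_def using that by (rule inner_sum_left_Basis)
  have "z \<in> cbox (- h) h"
    unfolding mem_box
  proof
    fix b :: 'a assume b: "b \<in> Basis"
    show "(- h) \<bullet> b \<le> z \<bullet> b \<and> z \<bullet> b \<le> h \<bullet> b"
      using h[OF b] by (auto simp: zb[OF b] sgn_if)
  qed
  from polar_gauge_ge[OF compact_cbox this, of w y]
  have "(\<Sum>b\<in>Basis. (w \<bullet> b) * ((y - z) \<bullet> b)) \<le> polar_gauge (cbox (- h) h) y w"
    by (simp add: euclidean_inner[of w "y - z"])
  also have "(\<Sum>b\<in>Basis. (w \<bullet> b) * ((y - z) \<bullet> b)) = (\<Sum>b\<in>Basis. (h \<bullet> b) * \<bar>w \<bullet> b\<bar> + (w \<bullet> b) * (y \<bullet> b))"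
    by (intro sum.cong refl) (auto simp: inner_diff_left zb sgn_if abs_if algebra_simps)
  finally show "(\<Sum>b\<in>Basis. (h \<bullet> b) * \<bar>w \<bullet> b\<bar> + (w \<bullet> b) * (y \<bullet> b)) \<le> polar_gauge (cbox (- h) h) y w" .
qed

lemma abs_less_of_mem_box:
  fixes h y b :: "'a::euclidean_space"
  assumes "y \<in> box (- h) h" "b \<in> Basis"
  shows "\<bar>y \<bullet> b\<bar> < h \<bullet> b"
  using assms by (auto simp: mem_box abs_less_iff)

text \<open>The gauge of a box is a sum of functions of single coordinates, so the integral factorises.\<close>
lemma polar_moment_0_box:
  fixes h y :: "'a::euclidean_space"
  assumes y: "y \<in> box (- h) h"
  shows "polar_moment (cbox (- h) h) 0 0 y = (\<Prod>b\<in>Basis. 2 * (h \<bullet> b) / ((h \<bullet> b)\<^sup>2 - (y \<bullet> b)\<^sup>2))"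
proof -
  note hy = abs_less_of_mem_box[OF y]
  have h: "0 < h \<bullet> b" if "b \<in> Basis" for b using hy[OF that] by simp
  have nn: "0 \<le> 2 * (h \<bullet> b) / ((h \<bullet> b)\<^sup>2 - (y \<bullet> b)\<^sup>2)" if "b \<in> Basis" for b
    using h[OF that] hy[OF that] abs_le_square_iff[of "y \<bullet> b" "h \<bullet> b"] by (auto intro!: divide_nonneg_nonneg)
  have e: "exp (- polar_gauge (cbox (- h) h) y w)
      = (\<Prod>b\<in>Basis. exp (- ((h \<bullet> b) * \<bar>w \<bullet> b\<bar> + (w \<bullet> b) * (y \<bullet> b))))" for w
    by (simp only: polar_gauge_box[OF h] sum_negf[symmetric] exp_sum[OF finite_Basis])
  have "(\<integral>\<^sup>+w. ennreal (exp (- polar_gauge (cbox (- h) h) y w)) \<partial>lborel)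
      = (\<Prod>b\<in>Basis. \<integral>\<^sup>+x. ennreal (exp (- ((h \<bullet> b) * \<bar>x\<bar> + x * (y \<bullet> b)))) \<partial>lborel)"
    unfolding e
    using nn_integral_lborel_prod[of "\<lambda>b x. ennreal (exp (- ((h \<bullet> b) * \<bar>x\<bar> + x * (y \<bullet> b))))"]
    by (simp add: prod_ennreal)
  also have "\<dots> = (\<Prod>b\<in>Basis. ennreal (2 * (h \<bullet> b) / ((h \<bullet> b)\<^sup>2 - (y \<bullet> b)\<^sup>2)))"
    by (intro prod.cong refl nn_integral_two_sided_exp hy)
  also have "\<dots> = ennreal (\<Prod>b\<in>Basis. 2 * (h \<bullet> b) / ((h \<bullet> b)\<^sup>2 - (y \<bullet> b)\<^sup>2))"
    using nn by (rule prod_ennreal)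
  finally have *: "(\<integral>\<^sup>+w. ennreal (exp (- polar_gauge (cbox (- h) h) y w)) \<partial>lborel) = \<dots>" .
  interpret interior_point "cbox (- h) h" y
    using y by unfold_locales (auto simp: interior_cbox)
  have "polar_moment (cbox (- h) h) 0 0 y = enn2real (\<integral>\<^sup>+w. ennreal (exp (- polar_gauge (cbox (- h) h) y w)) \<partial>lborel)"
    unfolding polar_moment_def by (subst integral_eq_nn_integral) auto
  then show ?thesis unfolding * using nn by (simp add: prod_nonneg)
qed

text \<open>The first moment is read off from the logarithmic derivative of the explicit product.\<close>
lemma centroid_gap_box:
  fixes h y u :: "'a::euclidean_space"
  assumes y: "y \<in> box (- h) h"
  shows "centroid_gap (cbox (- h) h) u y =
    (real DIM('a) + 1) * (y \<bullet> u) / (1 - (norm y)\<^sup>2)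
    - (\<Sum>b\<in>Basis. 2 * (y \<bullet> b) * (u \<bullet> b) / ((h \<bullet> b)\<^sup>2 - (y \<bullet> b)\<^sup>2))"
proof -
  let ?K = "cbox (- h) h"
  interpret interior_point ?K y
    using y by unfold_locales (auto simp: interior_cbox)
  note hy = abs_less_of_mem_box
  have pos: "0 < h \<bullet> b" "0 < (h \<bullet> b)\<^sup>2 - (x \<bullet> b)\<^sup>2" if "x \<in> box (- h) h" "b \<in> Basis" for x b
    using hy[OF that] abs_le_square_iff[of "h \<bullet> b" "x \<bullet> b"] by (auto simp: not_le)
  have ln_eq: "ln (polar_moment ?K 0 0 x) = (\<Sum>b\<in>Basis. ln (2 * (h \<bullet> b)) - ln ((h \<bullet> b)\<^sup>2 - (x \<bullet> b)\<^sup>2))"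
    if "x \<in> box (- h) h" for x
  proof -
    have "ln (polar_moment ?K 0 0 x) = (\<Sum>b\<in>Basis. ln (2 * (h \<bullet> b) / ((h \<bullet> b)\<^sup>2 - (x \<bullet> b)\<^sup>2)))"
      unfolding polar_moment_0_box[OF that]
    proof (intro ln_prod finite_Basis)
      fix b :: 'a assume "b \<in> Basis"
      from pos[OF that this] show "2 * (h \<bullet> b) / ((h \<bullet> b)\<^sup>2 - (x \<bullet> b)\<^sup>2) \<noteq> 0" by auto
    qed
    also have "\<dots> = (\<Sum>b\<in>Basis. ln (2 * (h \<bullet> b)) - ln ((h \<bullet> b)\<^sup>2 - (x \<bullet> b)\<^sup>2))"
    proof (rule sum.cong[OF refl])
      fix b :: 'a assume "b \<in> Basis"
      from pos[OF that this]
      show "ln (2 * (h \<bullet> b) / ((h \<bullet> b)\<^sup>2 - (x \<bullet> b)\<^sup>2)) = ln (2 * (h \<bullet> b)) - ln ((h \<bullet> b)\<^sup>2 - (x \<bullet> b)\<^sup>2)"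
        by (subst ln_div) auto
    qed
    finally show ?thesis .
  qed
  have D0: "((\<lambda>t. polar_moment ?K 0 0 (y + t *\<^sub>R u)) has_real_derivative - polar_moment ?K u 1 y) (at 0)"
    using has_derivative_moment_0[of u 0] by (simp add: polar_moment_0_eq[of ?K u])
  have L0: "((\<lambda>t. ln (polar_moment ?K 0 0 (y + t *\<^sub>R u))) has_real_derivative
      inverse (polar_moment ?K 0 0 (y + 0 *\<^sub>R u)) * - polar_moment ?K u 1 y) (at 0)"
    using moment_0_pos[of 0] by (intro DERIV_chain2[OF DERIV_ln D0]) simp
  have D1: "((\<lambda>t. \<Sum>b\<in>Basis. ln (2 * (h \<bullet> b)) - ln ((h \<bullet> b)\<^sup>2 - ((y + t *\<^sub>R u) \<bullet> b)\<^sup>2)) has_real_derivative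
      (\<Sum>b\<in>Basis. 0 - inverse ((h \<bullet> b)\<^sup>2 - ((y + 0 *\<^sub>R u) \<bullet> b)\<^sup>2) * (- 2 * (y \<bullet> b) * (u \<bullet> b)))) (at 0)"
  proof (intro DERIV_sum DERIV_diff DERIV_const)
    fix b :: 'a assume b: "b \<in> Basis"
    have "((\<lambda>t. (h \<bullet> b)\<^sup>2 - ((y + t *\<^sub>R u) \<bullet> b)\<^sup>2) has_real_derivative (- 2 * (y \<bullet> b) * (u \<bullet> b))) (at 0)"
      by (auto simp: inner_add_left intro!: derivative_eq_intros)
    then show "((\<lambda>t. ln ((h \<bullet> b)\<^sup>2 - ((y + t *\<^sub>R u) \<bullet> b)\<^sup>2)) has_real_derivative
        inverse ((h \<bullet> b)\<^sup>2 - ((y + 0 *\<^sub>R u) \<bullet> b)\<^sup>2) * (- 2 * (y \<bullet> b) * (u \<bullet> b))) (at 0)"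
      using pos[OF y b] by (intro DERIV_chain2[OF DERIV_ln]) auto
  qed
  have ev: "\<forall>\<^sub>F t in nhds 0. (\<Sum>b\<in>Basis. ln (2 * (h \<bullet> b)) - ln ((h \<bullet> b)\<^sup>2 - ((y + t *\<^sub>R u) \<bullet> b)\<^sup>2))
      = ln (polar_moment ?K 0 0 (y + t *\<^sub>R u))"
  proof -
    have "open ((\<lambda>t. y + t *\<^sub>R u) -` box (- h) h)"
      by (intro open_vimage open_box continuous_intros)
    then have "\<forall>\<^sub>F t in nhds 0. t \<in> (\<lambda>t. y + t *\<^sub>R u) -` box (- h) h"
      using y by (intro eventually_nhds_in_open) auto
    then show ?thesis by eventually_elim (simp add: ln_eq)
  qed
  from DERIV_unique[OF L0 iffD1[OF DERIV_cong_ev[OF refl ev refl] D1]]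
  have "polar_moment ?K u 1 y / polar_moment ?K u 0 y
     = - (\<Sum>b\<in>Basis. 2 * (y \<bullet> b) * (u \<bullet> b) / ((h \<bullet> b)\<^sup>2 - (y \<bullet> b)\<^sup>2))"
    by (simp add: polar_moment_0_eq[of ?K u] inverse_eq_divide sum_negf minus_equation_iff[of "_ / _"])
  then show ?thesis by (simp add: centroid_gap_def)
qed

lemma centroid_gap_box_axis:
  fixes h b0 u :: "'a::euclidean_space"
  assumes h: "\<And>b. b \<in> Basis \<Longrightarrow> 0 < h \<bullet> b" and b0: "b0 \<in> Basis" and t: "\<bar>t\<bar> < h \<bullet> b0"
    and eq: "(real DIM('a) + 1) * t / (1 - t\<^sup>2) = 2 * t / ((h \<bullet> b0)\<^sup>2 - t\<^sup>2)"
  shows "t *\<^sub>R b0 \<in> box (- h) h" "centroid_gap (cbox (- h) h) u (t *\<^sub>R b0) = 0"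
proof -
  have inner: "(t *\<^sub>R b0) \<bullet> b = (if b = b0 then t else 0)" if "b \<in> Basis" for b
    using b0 that by (simp add: inner_Basis)
  show mem: "t *\<^sub>R b0 \<in> box (- h) h"
    unfolding mem_box
  proof
    fix b :: 'a assume b: "b \<in> Basis"
    show "(- h) \<bullet> b < (t *\<^sub>R b0) \<bullet> b \<and> (t *\<^sub>R b0) \<bullet> b < h \<bullet> b"
      using h[OF b] t unfolding inner[OF b] by (auto simp: abs_less_iff)
  qed
  have "(\<Sum>b\<in>Basis. 2 * ((t *\<^sub>R b0) \<bullet> b) * (u \<bullet> b) / ((h \<bullet> b)\<^sup>2 - ((t *\<^sub>R b0) \<bullet> b)\<^sup>2))
    = (\<Sum>b\<in>Basis. if b = b0 then 2 * t * (u \<bullet> b0) / ((h \<bullet> b0)\<^sup>2 - t\<^sup>2) else 0)"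
    by (intro sum.cong refl) (simp only: inner, simp)
  also have "\<dots> = 2 * t * (u \<bullet> b0) / ((h \<bullet> b0)\<^sup>2 - t\<^sup>2)" using b0 by simp
  also have "\<dots> = (2 * t / ((h \<bullet> b0)\<^sup>2 - t\<^sup>2)) * (u \<bullet> b0)" by simp
  also have "\<dots> = (real DIM('a) + 1) * t / (1 - t\<^sup>2) * (u \<bullet> b0)" unfolding eq ..
  finally show "centroid_gap (cbox (- h) h) u (t *\<^sub>R b0) = 0"
    unfolding centroid_gap_box[OF mem] using b0
    by (simp add: inner_commute power_mult_distrib)
qed

section \<open>Centroids of polars with respect to a common point\<close>

lemma centroid_polar_eq_iff_gap:
  fixes K :: "(real ^ 'n) set"
  assumes "compact K" "y \<in> interior K" "norm y < 1"
  shows "centroid (polar_wrt y K) = centroid (polar_wrt y (cball 0 1)) \<longleftrightarrow> (\<forall>u. centroid_gap K u y = 0)"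
  using centroid_polar_eq_iff[OF assms] by (simp add: centroid_gap_def)

lemma unique_common_centroid:
  fixes K :: "(real ^ 'n) set"
  assumes n: "CARD('n) \<ge> 2" and K: "convex_body K" "K \<subseteq> cball 0 1"
    and diam: "hyperbolic_diam K
      < ereal (ln ((1 + sqrt (2 / (real CARD('n) + 1))) / (1 - sqrt (2 / (real CARD('n) + 1)))))"
  shows "\<exists>!y. y \<in> interior K \<and> centroid (polar_wrt y K) = centroid (polar_wrt y (cball 0 1))"
proof -
  define r where "r = sqrt (2 / (real CARD('n) + 1))"
  have r: "0 < r" "r < 1" "r\<^sup>2 = 2 / (real CARD('n) + 1)"
    using n by (auto simp: r_def add_nonneg_pos real_sqrt_lt_1_iff)
  have K': "compact K" "convex K" "interior K \<noteq> {}" using K(1) by (auto simp: convex_body_def)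
  note D = hyperbolic_diam_lessD[OF K'(3) K(2) diam[folded r_def]]
  have eq: "centroid (polar_wrt y K) = centroid (polar_wrt y (cball 0 1)) \<longleftrightarrow> (\<forall>u. centroid_gap K u y = 0)"
    if "y \<in> interior K" for y
    using that D(1) interior_subset[of K] by (intro centroid_polar_eq_iff_gap K') auto
  obtain y where y: "y \<in> interior K" "\<And>u. centroid_gap K u y = 0"
    using centroid_gap_zero_exists[OF K'(1,2) D(1) K'(3)] by blast
  show ?thesis
  proof (rule ex1I[of _ y])
    show "y \<in> interior K \<and> centroid (polar_wrt y K) = centroid (polar_wrt y (cball 0 1))"
      using y eq by blast
  next
    fix z assume "z \<in> interior K \<and> centroid (polar_wrt z K) = centroid (polar_wrt z (cball 0 1))"
    then have z: "z \<in> interior K" "\<And>u. centroid_gap K u z = 0" using eq by blast+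
    show "z = y" by (rule centroid_gap_zero_unique[OF K'(1,2) D r z y])
  qed
qed

text \<open>The box has half-length \<open>r\<close> along one axis and a small half-length \<open>\<epsilon>\<close> along the others.  On the long
  axis at parameter \<open>t\<close>, the centroids agree if \<open>(d + 1) t / (1 - t\<^sup>2) = 2 t / (r\<^sup>2 - t\<^sup>2)\<close>.  Besides
  \<open>t = 0\<close> this has the solutions \<open>t\<^sup>2 = ((d + 1) r\<^sup>2 - 2) / (d - 1)\<close>, and \<open>2 / (d + 1) < r\<^sup>2 < 1\<close> is
  exactly what puts them into the box and away from \<open>0\<close>.\<close>
lemma box_with_two_common_centroids:
  fixes r \<rho> :: real
  assumes n: "CARD('n::finite) \<ge> 2" and r: "2 / (real CARD('n) + 1) < r\<^sup>2" "0 < r" "r < \<rho>" "\<rho> < 1"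
  obtains K :: "(real ^ 'n) set" where "convex_body K" "K \<subseteq> cball 0 \<rho>"
    "\<not> (\<exists>!y. y \<in> interior K \<and> centroid (polar_wrt y K) = centroid (polar_wrt y (cball 0 1)))"
proof -
  define d where "d = real CARD('n)"
  have d: "2 \<le> d" using n by (simp add: d_def)
  obtain b0 :: "real ^ 'n" where b0: "b0 \<in> Basis" using nonempty_Basis by blast
  have r2: "r\<^sup>2 < \<rho>\<^sup>2" using r by (intro power_strict_mono) auto
  define \<epsilon> where "\<epsilon> = sqrt ((\<rho>\<^sup>2 - r\<^sup>2) / d)"
  have \<epsilon>: "0 < \<epsilon>" "\<epsilon>\<^sup>2 = (\<rho>\<^sup>2 - r\<^sup>2) / d" using r2 d by (auto simp: \<epsilon>_def)
  define h :: "real ^ 'n" where "h = (\<Sum>b\<in>Basis. (if b = b0 then r else \<epsilon>) *\<^sub>R b)"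
  have hb: "h \<bullet> b = (if b = b0 then r else \<epsilon>)" if "b \<in> Basis" for b
    unfolding h_def using that by (rule inner_sum_left_Basis)
  have h: "0 < h \<bullet> b" if "b \<in> Basis" for b using hb[OF that] r \<epsilon> by simp
  define K where "K = cbox (- h) h"
  have intK: "interior K = box (- h) h" by (simp add: K_def interior_cbox)
  define t where "t = sqrt (((d + 1) * r\<^sup>2 - 2) / (d - 1))"
  have "2 < (d + 1) * r\<^sup>2" using r(1) d by (simp add: d_def[symmetric] pos_divide_less_eq mult.commute)
  then have t: "0 < t" "t\<^sup>2 = ((d + 1) * r\<^sup>2 - 2) / (d - 1)" using d by (auto simp: t_def)
  have r1: "r\<^sup>2 < 1" using r by (simp add: abs_square_less_1)
  then have tr2: "t\<^sup>2 < r\<^sup>2" unfolding t(2) using d by (simp add: pos_divide_less_eq algebra_simps)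
  then have tr: "t < r" using r(2) by (rule power2_less_imp_less[OF _ less_imp_le])
  have crit: "(real DIM(real ^ 'n) + 1) * t / (1 - t\<^sup>2) = 2 * t / ((h \<bullet> b0)\<^sup>2 - t\<^sup>2)"
  proof -
    have "(d - 1) * t\<^sup>2 = (d + 1) * r\<^sup>2 - 2" unfolding t(2) using d by simp
    then have "(d + 1) * (r\<^sup>2 - t\<^sup>2) = 2 * (1 - t\<^sup>2)" by (simp add: algebra_simps)
    then have "(d + 1) * t * (r\<^sup>2 - t\<^sup>2) = 2 * t * (1 - t\<^sup>2)" by (simp add: mult.commute mult.left_commute)
    then have "(d + 1) * t / (1 - t\<^sup>2) = 2 * t / (r\<^sup>2 - t\<^sup>2)"
      using tr2 r1 by (subst frac_eq_eq) auto
    then show ?thesis using hb[OF b0] by (simp add: d_def)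
  qed
  have sub: "K \<subseteq> cball 0 \<rho>"
  proof
    fix z assume z: "z \<in> K"
    have "(norm z)\<^sup>2 = (\<Sum>b\<in>Basis. (z \<bullet> b)\<^sup>2)"
      unfolding power2_norm_eq_inner by (subst euclidean_inner) (simp add: power2_eq_square)
    also have "\<dots> \<le> (\<Sum>b\<in>Basis. (h \<bullet> b)\<^sup>2)"
    proof (rule sum_mono)
      fix b :: "real ^ 'n" assume b: "b \<in> Basis"
      then have "\<bar>z \<bullet> b\<bar> \<le> \<bar>h \<bullet> b\<bar>" using z h[OF b] by (auto simp: K_def mem_box abs_le_iff)
      then show "(z \<bullet> b)\<^sup>2 \<le> (h \<bullet> b)\<^sup>2" by (simp add: abs_le_square_iff)
    qed
    also have "\<dots> \<le> (\<Sum>b\<in>(Basis :: (real ^ 'n) set). (if b = b0 then r\<^sup>2 else 0) + \<epsilon>\<^sup>2)"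
      by (intro sum_mono) (auto simp: hb)
    also have "\<dots> = r\<^sup>2 + d * \<epsilon>\<^sup>2"
      using b0 by (simp add: sum.distrib d_def)
    also have "\<dots> = \<rho>\<^sup>2" using d by (simp add: \<epsilon>(2))
    finally have "norm z \<le> \<rho>" by (rule power2_le_imp_le) (use r in simp)
    then show "z \<in> cball 0 \<rho>" by simp
  qed
  have K1: "norm y < 1" if "y \<in> interior K" for y
  proof -
    have "y \<in> cball 0 \<rho>" using that interior_subset[of K] sub by blast
    then show ?thesis using r(4) by simp
  qed
  have cK: "compact K" by (simp add: K_def)
  have zero: "s *\<^sub>R b0 \<in> interior K \<and> centroid (polar_wrt (s *\<^sub>R b0) K) = centroid (polar_wrt (s *\<^sub>R b0) (cball 0 1))"
    if s: "\<bar>s\<bar> < h \<bullet> b0" "(real DIM(real ^ 'n) + 1) * s / (1 - s\<^sup>2) = 2 * s / ((h \<bullet> b0)\<^sup>2 - s\<^sup>2)" for s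
  proof -
    have mem: "s *\<^sub>R b0 \<in> interior K"
      unfolding intK by (rule centroid_gap_box_axis(1)[OF h b0 s])
    have "centroid_gap K u (s *\<^sub>R b0) = 0" for u
      unfolding K_def by (rule centroid_gap_box_axis(2)[OF h b0 s])
    then show ?thesis
      using centroid_polar_eq_iff_gap[OF cK mem K1[OF mem]] mem by blast
  qed
  have z0: "0 *\<^sub>R b0 \<in> interior K \<and> centroid (polar_wrt (0 *\<^sub>R b0) K) = centroid (polar_wrt (0 *\<^sub>R b0) (cball 0 1))"
    by (rule zero) (use h[OF b0] in simp_all)
  have zt: "t *\<^sub>R b0 \<in> interior K \<and> centroid (polar_wrt (t *\<^sub>R b0) K) = centroid (polar_wrt (t *\<^sub>R b0) (cball 0 1))"
    by (rule zero[OF _ crit]) (use hb[OF b0] t(1) tr in simp)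
  have "0 *\<^sub>R b0 \<noteq> t *\<^sub>R b0" using t(1) nonzero_Basis[OF b0] by simp
  with z0 zt have "\<not> (\<exists>!y. y \<in> interior K \<and> centroid (polar_wrt y K) = centroid (polar_wrt y (cball 0 1)))"
    by blast
  moreover have "convex_body K"
    unfolding convex_body_def using z0 cK by (auto simp: K_def)
  ultimately show ?thesis using sub that by blast
qed

theorem theorem8:
  assumes "CARD('n::finite) \<ge> 2"
  shows "(\<forall>K :: (real ^ 'n) set.
            convex_body K \<and> K \<subseteq> cball 0 1 \<and>
            hyperbolic_diam K
              < ereal (ln ((1 + sqrt (2 / (real CARD('n) + 1))) / (1 - sqrt (2 / (real CARD('n) + 1)))))
            \<longrightarrow> (\<exists>!y. y \<in> interior K \<and>
                   centroid (polar_wrt y K) = centroid (polar_wrt y (cball 0 1)))) \<and>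
         (\<forall>C > ln ((1 + sqrt (2 / (real CARD('n) + 1))) / (1 - sqrt (2 / (real CARD('n) + 1)))).
            \<exists>K :: (real ^ 'n) set.
              convex_body K \<and> K \<subseteq> cball 0 1 \<and> hyperbolic_diam K < ereal C \<and>
              \<not> (\<exists>!y. y \<in> interior K \<and>
                   centroid (polar_wrt y K) = centroid (polar_wrt y (cball 0 1))))"
proof (intro conjI allI impI)
  fix K :: "(real ^ 'n) set"
  assume "convex_body K \<and> K \<subseteq> cball 0 1 \<and>
    hyperbolic_diam K
      < ereal (ln ((1 + sqrt (2 / (real CARD('n) + 1))) / (1 - sqrt (2 / (real CARD('n) + 1)))))"
  then show "\<exists>!y. y \<in> interior K \<and> centroid (polar_wrt y K) = centroid (polar_wrt y (cball 0 1))"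
    by (intro unique_common_centroid assms) auto
next
  fix C assume C: "ln ((1 + sqrt (2 / (real CARD('n) + 1))) / (1 - sqrt (2 / (real CARD('n) + 1)))) < C"
  \<comment> \<open>Choose \<open>r0 < r < \<rho>\<close> with \<open>\<rho>\<close> so close to \<open>r0\<close> that a Euclidean ball of radius \<open>\<rho>\<close> has
    hyperbolic diameter below \<open>C\<close>; a thin box of half-length \<open>r\<close> fits into this ball.\<close>
  define r0 where "r0 = sqrt (2 / (real CARD('n) + 1))"
  have r0: "0 < r0" "r0 < 1" "r0\<^sup>2 = 2 / (real CARD('n) + 1)"
    using assms by (auto simp: r0_def add_nonneg_pos real_sqrt_lt_1_iff)
  have "isCont (\<lambda>x. ln ((1 + x) / (1 - x))) r0"
    using r0 by (intro continuous_intros) auto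
  then have "\<forall>\<^sub>F x in at_right r0. ln ((1 + x) / (1 - x)) < C"
    using C unfolding r0_def[symmetric] isCont_def
    by (intro order_tendstoD(2)[OF tendsto_mono[OF at_le]]) auto
  then have "\<forall>\<^sub>F x in at_right r0. ln ((1 + x) / (1 - x)) < C \<and> r0 < x \<and> x < 1"
    using eventually_at_right_real[OF r0(2)] by eventually_elim auto
  then obtain \<rho> where \<rho>: "ln ((1 + \<rho>) / (1 - \<rho>)) < C" "r0 < \<rho>" "\<rho> < 1"
    using eventually_happens[of _ "at_right r0"] trivial_limit_at_right_real by blast
  define r where "r = (r0 + \<rho>) / 2"
  have r: "0 < r" "r < \<rho>" "r0 < r" using \<rho> r0 by (auto simp: r_def)
  have "r0\<^sup>2 < r\<^sup>2" using r r0 by (intro power_strict_mono) auto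
  then have r2: "2 / (real CARD('n) + 1) < r\<^sup>2" using r0(3) by simp
  obtain K :: "(real ^ 'n) set" where K: "convex_body K" "K \<subseteq> cball 0 \<rho>"
    "\<not> (\<exists>!y. y \<in> interior K \<and> centroid (polar_wrt y K) = centroid (polar_wrt y (cball 0 1)))"
    by (rule box_with_two_common_centroids[OF assms r2 r(1,2) \<rho>(3)])
  have "hyperbolic_diam K \<le> ereal (ln ((1 + \<rho>) / (1 - \<rho>)))"
    unfolding hyperbolic_diam_def
    using K(2) \<rho>(3) by (intro SUP_least hyperbolic_dist_le_of_norm_le) auto
  also have "\<dots> < ereal C" using \<rho>(1) by simp
  finally have "hyperbolic_diam K < ereal C" .
  moreover have "K \<subseteq> cball 0 1" using K(2) \<rho>(3) by auto
  ultimately show "\<exists>K :: (real ^ 'n) set.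
      convex_body K \<and> K \<subseteq> cball 0 1 \<and> hyperbolic_diam K < ereal C \<and>
      \<not> (\<exists>!y. y \<in> interior K \<and> centroid (polar_wrt y K) = centroid (polar_wrt y (cball 0 1)))"
    using K by blast
qed

end
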